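(* For every integer $k\geq 3$ there are positive constants $d_{k\text{-par.}}$ and $\varepsilon_{k\text{-par.}}$ such that, in the bounded degree model with degree bound $d_{k\text{-par.}}$ and proximity parameter $\varepsilon_{k\text{-par.}}$, the query complexity of testing $k$-partiteness of $k$-uniform $n$-vertex hypergraphs is $\Omega(n)$.
   Context: A hypergraph $H$ on vertex set $[n]$ is $k$-uniform if every hyperedge has exactly $k$ vertices. It is $k$-partite if there is a map $V(H)\to\{1,\dots,k\}$ such that the $k$ vertices of every hyperedge receive $k$ distinct colors. Bounded degree model: for a fixed degree bound $\Delta$, a hypergraph of maximum degree at most $\Delta$ is given by oracle access to lists $A_1,\dots,A_n$, where $A_i$ has length $\Delta$ and contains the hyperedges incident to vertex $i$ (in a fixed global order) padded with dummy symbols $\bot$; a query asks for an entry of some $A_i$. The distance between $H_1=([n],E_1)$ and $H_2=([n],E_2)$ is $(|E_1\setminus E_2|+|E_2\setminus E_1|)/(\Delta n)$; $H$ is $\varepsilon$-far from a property if its distance to every $k$-uniform $n$-vertex hypergraph with the property exceeds $\varepsilon$. An $\varepsilon$-tester accepts with probability at least $2/3$ hypergraphs with the property and with probability at most $1/3$ hypergraphs $\varepsilon$-far from it; "query complexity $\Omega(n)$" means every such tester (for the given $\Delta$ and $\varepsilon$) makes $\Omega(n)$ queries in the worst case over $n$-vertex hypergraphs of maximum degree at most $\Delta$. *)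

theory Defs
  imports "HOL-Probability.Probability_Mass_Function"
begin

text \<open>
  Hypergraphs have vertex set \<open>{1..n}\<close> and are represented by their sets of hyperedges.
\<close>

definition k_subsets :: "nat \<Rightarrow> nat \<Rightarrow> nat set set" where
  "k_subsets k n = {e. e \<subseteq> {1..n} \<and> card e = k}"

definition uniform_hypergraph :: "nat \<Rightarrow> nat \<Rightarrow> nat set set \<Rightarrow> bool" where
  "uniform_hypergraph k n E \<longleftrightarrow> E \<subseteq> k_subsets k n"

definition max_degree_le :: "nat \<Rightarrow> nat \<Rightarrow> nat set set \<Rightarrow> bool" where
  "max_degree_le \<Delta> n E \<longleftrightarrow> (\<forall>v\<in>{1..n}. card {e \<in> E. v \<in> e} \<le> \<Delta>)"

definition k_partite :: "nat \<Rightarrow> nat \<Rightarrow> nat set set \<Rightarrow> bool" where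
  "k_partite k n E \<longleftrightarrow> (\<exists>c. c ` {1..n} \<subseteq> {1..k} \<and> (\<forall>e\<in>E. inj_on c e))"

definition hg_dist :: "nat \<Rightarrow> nat \<Rightarrow> nat set set \<Rightarrow> nat set set \<Rightarrow> real" where
  "hg_dist \<Delta> n E\<^sub>1 E\<^sub>2 = real (card (E\<^sub>1 - E\<^sub>2) + card (E\<^sub>2 - E\<^sub>1)) / (real \<Delta> * real n)"

text \<open>
  A property of \<open>n\<close>-vertex hypergraphs is a predicate \<open>P\<close> on hyperedge sets. As in the usual
  definition, the hypergraphs with the property are not required to have bounded degree here.
\<close>

definition far_from ::
    "nat \<Rightarrow> nat \<Rightarrow> nat \<Rightarrow> real \<Rightarrow> (nat set set \<Rightarrow> bool) \<Rightarrow> nat set set \<Rightarrow> bool" where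
  "far_from k \<Delta> n \<epsilon> P E \<longleftrightarrow>
     (\<forall>E'. uniform_hypergraph k n E' \<and> P E' \<longrightarrow> hg_dist \<Delta> n E E' > \<epsilon>)"

text \<open>
  A global order on the potential hyperedges is an enumeration \<open>L\<close> of all \<open>k\<close>-subsets of
  \<open>{1..n}\<close> without repetitions. The dummy symbol is \<open>None\<close>.
\<close>

definition edge_order :: "nat \<Rightarrow> nat \<Rightarrow> nat set list \<Rightarrow> bool" where
  "edge_order k n L \<longleftrightarrow> distinct L \<and> set L = k_subsets k n"

definition incidence_list ::
    "nat \<Rightarrow> nat set list \<Rightarrow> nat set set \<Rightarrow> nat \<Rightarrow> nat set option list" where
  "incidence_list \<Delta> L E i =
     (let es = filter (\<lambda>e. e \<in> E \<and> i \<in> e) L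
      in map Some es @ replicate (\<Delta> - length es) None)"

text \<open>
  List positions are counted from \<open>0\<close>. Queries outside the lists are answered by the dummy
  symbol and hence are of no use to an algorithm.
\<close>

definition list_access ::
    "nat \<Rightarrow> nat \<Rightarrow> nat set list \<Rightarrow> nat set set \<Rightarrow> nat \<Rightarrow> nat \<Rightarrow> nat set option" where
  "list_access \<Delta> n L E i j =
     (if i \<in> {1..n} \<and> j < \<Delta> then incidence_list \<Delta> L E i ! j else None)"

text \<open>
  A deterministic adaptive algorithm for a fixed \<open>n\<close> is a decision tree: \<open>Query i j f\<close> asks for
  entry \<open>j\<close> of the list of vertex \<open>i\<close> and continues with \<open>f a\<close> on answer \<open>a\<close>. A randomized
  algorithm is a probability distribution on decision trees. No computability or uniformity
  in \<open>n\<close> is imposed.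
\<close>

datatype decision_tree =
    Decide bool
  | Query nat nat "nat set option \<Rightarrow> decision_tree"

primrec accepts :: "(nat \<Rightarrow> nat \<Rightarrow> nat set option) \<Rightarrow> decision_tree \<Rightarrow> bool" where
  "accepts A (Decide b) = b"
| "accepts A (Query i j f) = accepts A (f (A i j))"

primrec num_queries :: "(nat \<Rightarrow> nat \<Rightarrow> nat set option) \<Rightarrow> decision_tree \<Rightarrow> nat" where
  "num_queries A (Decide b) = 0"
| "num_queries A (Query i j f) = Suc (num_queries A (f (A i j)))"

definition accept_prob ::
    "nat \<Rightarrow> nat \<Rightarrow> nat set list \<Rightarrow> decision_tree pmf \<Rightarrow> nat set set \<Rightarrow> real" where
  "accept_prob \<Delta> n L T E = measure_pmf.prob T {t. accepts (list_access \<Delta> n L E) t}"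

definition is_tester ::
    "nat \<Rightarrow> nat \<Rightarrow> real \<Rightarrow> nat \<Rightarrow> nat set list \<Rightarrow> (nat set set \<Rightarrow> bool) \<Rightarrow> decision_tree pmf \<Rightarrow> bool"
  where
  "is_tester k \<Delta> \<epsilon> n L P T \<longleftrightarrow>
     (\<forall>E. uniform_hypergraph k n E \<and> max_degree_le \<Delta> n E \<longrightarrow>
        (P E \<longrightarrow> accept_prob \<Delta> n L T E \<ge> 2 / 3) \<and>
        (far_from k \<Delta> n \<epsilon> P E \<longrightarrow> accept_prob \<Delta> n L T E \<le> 1 / 3))"

text \<open>
  Worst case over the input hypergraphs and over the random choices of the algorithm; the value
  is infinite if the number of queries is unbounded.
\<close>

definition worst_case_queries ::
    "nat \<Rightarrow> nat \<Rightarrow> nat \<Rightarrow> nat set list \<Rightarrow> decision_tree pmf \<Rightarrow> enat" where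
  "worst_case_queries k \<Delta> n L T =
     (SUP (E, t) \<in> {E. uniform_hypergraph k n E \<and> max_degree_le \<Delta> n E} \<times> set_pmf T.
        enat (num_queries (list_access \<Delta> n L E) t))"

definition query_complexity ::
    "nat \<Rightarrow> nat \<Rightarrow> real \<Rightarrow> nat \<Rightarrow> nat set list \<Rightarrow> (nat set set \<Rightarrow> bool) \<Rightarrow> enat" where
  "query_complexity k \<Delta> \<epsilon> n L P =
     (INF T \<in> {T. is_tester k \<Delta> \<epsilon> n L P T}. worst_case_queries k \<Delta> n L T)"

text \<open>
  The Landau symbol \<open>\<Omega>(n)\<close>, spelled out for functions into the extended natural numbers.
\<close>

definition at_least_linear :: "(nat \<Rightarrow> enat) \<Rightarrow> bool" where
  "at_least_linear q \<longleftrightarrow>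
     (\<exists>c>0. \<forall>\<^sub>F n in sequentially. ereal (c * real n) \<le> ereal_of_enat (q n))"

end

theory Submission
  imports Defs
begin

text \<open>
  Take \<open>4N\<close> parity equations with four variables each in at most \<open>2N\<close> variables with values in
  \<open>{0, 1}\<close>, each variable occurring a bounded number of times, such that any set of
  at most \<open>N / 1728\<close> equations has a variable occurring exactly once in it. For a uniformly random right-hand side
  the system is far from satisfiable. If the right-hand side is instead produced by a random
  assignment, the system is satisfiable, but any \<open>N / 1728\<close> of the right-hand sides are still uniform
  and independent, so an algorithm that sees fewer of them cannot tell the two cases apart. Each
  equation is replaced by a gadget of constant size that is \<open>k\<close>-partite iff the equation holds, where
  every query reveals the right-hand sides of at most 16 equations.

  The equations come from a random map, by a union bound over all sets of equations with few
  neighbours. Variables occurring too often are split into copies, which preserves expansion.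
\<close>

section \<open>Sparse expanding parity systems\<close>

text \<open>k^k/k! is a single term of the power series of exp k, and e is at most 3.\<close>

lemma power_div_3_le_fact: "(real k / 3) ^ k \<le> fact k"
proof -
  have s: "(\<lambda>n. real k ^ n / fact n) sums exp (real k)"
    using exp_converges[of "real k"] by (simp add: divide_inverse_commute)
  have "(\<Sum>n\<in>{k}. real k ^ n / fact n) \<le> (\<Sum>n. real k ^ n / fact n)"
    using s by (intro sum_le_suminf) (auto simp: sums_iff)
  hence "real k ^ k / fact k \<le> exp (real k)" using s by (simp add: sums_iff)
  also have "\<dots> \<le> 3 ^ k"
    by (metis exp_le exp_of_nat_mult mult.right_neutral power_mono exp_ge_zero)
  finally show ?thesis by (simp add: field_simps)
qed

text \<open>First moment argument: a map violating the bound for a set \<open>S\<close> of s rows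
  sends all 4s slots of \<open>S\<close> into some set of 2s values. Summed over s, \<open>S\<close>
  and the set of values, the proportion of such maps is below 1.\<close>

lemma exists_expanding_map:
  fixes N :: nat
  assumes "N > 0"
  obtains f :: "nat \<times> nat \<Rightarrow> nat" where
    "f ` ({..<4*N} \<times> {..<4}) \<subseteq> {..<N}"
    "\<And>S. S \<subseteq> {..<4*N} \<Longrightarrow> S \<noteq> {} \<Longrightarrow> 1728 * card S \<le> N
        \<Longrightarrow> card (f ` (S \<times> {..<4})) > 2 * card S"
proof -
  define I :: "(nat \<times> nat) set" where "I = {..<4*N} \<times> {..<4}"
  define F where "F = I \<rightarrow>\<^sub>E {..<N}"
  define Rs where "Rs s = {S. S \<subseteq> {..<4*N} \<and> card S = s}" for s
  define Us where "Us s = {U. U \<subseteq> {..<N} \<and> card U = 2 * s}" for s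
  define bad where "bad S U = (\<Pi>\<^sub>E h\<in>I. if h \<in> S \<times> {..<4} then U else {..<N})" for S U :: "nat set"
  have finI: "finite I" and cardI: "card I = 16 * N" by (auto simp: I_def)
  have card_bad: "real (card (bad S U)) \<le> real N ^ (16*N) * (2 * real s / real N) ^ (4 * s)"
    if "S \<in> Rs s" "U \<in> Us s" for S U s
  proof -
    have S: "S \<subseteq> {..<4*N}" "card S = s" "card U = 2 * s" using that by (auto simp: Rs_def Us_def)
    have sub: "S \<times> {..<4} \<subseteq> I" using S by (auto simp: I_def)
    have le: "4 * s \<le> 16 * N"
      using card_mono[OF finI sub] cardI S by (simp add: card_cartesian_product)
    have "card (bad S U) = (\<Prod>h\<in>I. if h \<in> S \<times> {..<4} then 2 * s else N)"
      using finI S by (simp add: bad_def card_PiE if_distrib cong: if_cong)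
    also have "\<dots> = (\<Prod>h\<in>S \<times> {..<4::nat}. 2 * s) * (\<Prod>h\<in>I - S \<times> {..<4}. N)"
      using finI sub by (subst prod.subset_diff[OF sub finI]) (auto intro!: arg_cong2[where f="(*)"] prod.cong)
    also have "\<dots> = (2 * s)^(4 * s) * N^(16*N - 4 * s)"
      using S sub finI cardI by (simp add: card_cartesian_product card_Diff_subset finite_subset mult.commute)
    finally have "real (card (bad S U)) = (2 * real s)^(4 * s) * real N^(16*N - 4 * s)" by simp
    also have "\<dots> = real N ^ (16*N) * (2 * real s / real N) ^ (4 * s)"
      using le assms by (simp add: power_diff power_divide)
    finally show ?thesis by simp
  qed
  have finR: "finite (Rs s)" "finite (Us s)" for s by (auto simp: Rs_def Us_def)
  have cR: "card (Rs s) = (4*N) choose s" for s unfolding Rs_def by (simp add: n_subsets)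
  have cU: "card (Us s) = N choose (2 * s)" for s unfolding Us_def by (simp add: n_subsets)
  \<comment> \<open>The usual bound (en/k)^k with e rounded up to 3.\<close>
  have binom: "real (n choose k) \<le> (3 * real n / real k) ^ k" if "k > 0" for n k
  proof -
    have "real (n choose k) * fact k \<le> real n ^ k"
      by (metis binomial_fact_pow of_nat_fact of_nat_le_iff of_nat_mult of_nat_power)
    moreover have "real (n choose k) * (real k / 3) ^ k \<le> real (n choose k) * fact k"
      by (intro mult_left_mono power_div_3_le_fact) auto
    ultimately have "real (n choose k) * (real k / 3) ^ k \<le> real n ^ k" by linarith
    thus ?thesis using that by (simp add: field_simps power_divide)
  qed
  have union_term: "real (card (Rs s)) * real (card (Us s)) * (2 * real s / real N) ^ (4 * s) \<le> (1/4) ^ s"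
    if s: "s > 0" "1728 * s \<le> N" for s
  proof -
    have "real (card (Rs s)) * real (card (Us s)) * (2 * real s / real N) ^ (4 * s)
       \<le> (3 * real (4*N) / real s) ^ s * (3 * real N / real (2 * s)) ^ (2 * s) * (2 * real s / real N) ^ (4 * s)"
      unfolding cR cU using s by (intro mult_right_mono mult_mono binom) auto
    also have "\<dots> = ((3 * real (4*N) / real s) * (3 * real N / real (2 * s))^2 * (2 * real s / real N) ^ 4) ^ s"
      by (simp only: power_mult power_mult_distrib)
    \<comment> \<open>The binomials contribute three factors N/s and the four slots four factors
      s/N, so one factor s/N survives. The threshold 1728 is 4 * 432, which makes the result at most
      1/4.\<close>
    also have "(3 * real (4*N) / real s) * (3 * real N / real (2 * s))^2 * (2 * real s / real N) ^ 4
        = 432 * real s / real N"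
      using s assms by (simp add: field_simps power2_eq_square power4_eq_xxxx)
    also have "(432 * real s / real N) ^ s \<le> (1/4) ^ s"
      using s assms by (intro power_mono) (auto simp: field_simps)
    finally show ?thesis .
  qed
  define J where "J = {1..N div 1728}"
  define allbad where "allbad = (\<Union>s\<in>J. \<Union>S\<in>Rs s. \<Union>U\<in>Us s. bad S U)"
  have finb: "finite (bad S U)" if "U \<in> Us s" for S U s
    unfolding bad_def using finI that by (intro finite_PiE) (auto simp: Us_def finite_subset)
  have "real (card allbad) \<le> (\<Sum>s\<in>J. \<Sum>S\<in>Rs s. \<Sum>U\<in>Us s. real (card (bad S U)))"
  proof -
    have "card allbad \<le> (\<Sum>s\<in>J. \<Sum>S\<in>Rs s. \<Sum>U\<in>Us s. card (bad S U))"
      unfolding allbad_def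
      by (intro order.trans[OF card_UN_le] sum_mono) (auto simp: J_def finR)
    thus ?thesis by (metis (mono_tags, lifting) of_nat_le_iff of_nat_sum sum.cong)
  qed
  also have "\<dots> \<le> (\<Sum>s\<in>J. \<Sum>S\<in>Rs s. \<Sum>U\<in>Us s. real N ^ (16*N) * (2 * real s / real N) ^ (4 * s))"
    by (intro sum_mono card_bad)
  also have "\<dots> = real N ^ (16*N) * (\<Sum>s\<in>J. real (card (Rs s)) * real (card (Us s)) * (2 * real s / real N) ^ (4 * s))"
    by (simp add: sum_distrib_left mult_ac)
  also have "\<dots> \<le> real N ^ (16*N) * (\<Sum>s\<in>J. (1/4) ^ s)"
    by (intro mult_left_mono sum_mono union_term) (auto simp: J_def)
  also have "\<dots> < real N ^ (16*N) * 1"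
  proof -
    have "(\<Sum>s=1..n. (1/4::real) ^ s) < 1" for n
    proof -
      have "3 * (\<Sum>s=1..n. (1/4::real) ^ s) = 1 - (1/4)^n"
        by (induction n) (simp_all add: distrib_left)
      moreover have "(1/4::real) ^ n > 0" by simp
      ultimately show ?thesis by linarith
    qed
    thus ?thesis using assms unfolding J_def by (intro mult_strict_left_mono) auto
  qed
  also have "\<dots> = real (card F)" using finI cardI by (simp add: F_def card_PiE)
  finally have "card allbad < card F" by simp
  moreover have "finite allbad" unfolding allbad_def by (auto simp: J_def finR intro: finb)
  ultimately obtain f where f: "f \<in> F" "f \<notin> allbad"
    by (metis card_mono linorder_not_less subsetI)
  show ?thesis
  proof
    show "f ` ({..<4*N} \<times> {..<4}) \<subseteq> {..<N}"
      using f(1) by (auto simp: F_def I_def)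
    fix S assume S: "S \<subseteq> {..<4*N}" "S \<noteq> {}" "1728 * card S \<le> N"
    show "card (f ` (S \<times> {..<4})) > 2 * card S"
    proof (rule ccontr)
      assume "\<not> ?thesis"
      hence le: "card (f ` (S \<times> {..<4})) \<le> 2 * card S" by simp
      have sub: "f ` (S \<times> {..<4}) \<subseteq> {..<N}" using f(1) S(1) by (auto simp: F_def I_def)
      have fS: "finite S" using S(1) finite_subset by blast
      \<comment> \<open>A smaller image is enlarged to exactly 2s values, the size over which the
        union bound runs.\<close>
      obtain U where U: "f ` (S \<times> {..<4}) \<subseteq> U" "U \<subseteq> {..<N}" "card U = 2 * card S"
        using exists_subset_between[OF le _ sub] S(3) by auto
      have "f \<in> bad S U"
        using f(1) U(1) unfolding F_def bad_def PiE_def Pi_def by auto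
      moreover have "card S \<in> J" using S fS by (auto simp: J_def Suc_le_eq card_gt_0_iff)
      ultimately have "f \<in> allbad" using S U unfolding allbad_def Rs_def Us_def by blast
      thus False using f(2) by simp
    qed
  qed
qed

text \<open>Number the elements of \<open>F\<close> consecutively and cut the numbering into blocks
  of length \<open>D\<close>; \<open>g\<close> is the index of the block.\<close>

lemma split_into_small_fibres:
  fixes F :: "'a set"
  assumes "finite F" "D > 0"
  obtains g :: "'a \<Rightarrow> nat" where
    "\<And>c. card {h \<in> F. g h = c} \<le> D" "card (g ` F) \<le> card F div D + 1"
proof -
  obtain r where r: "bij_betw r F {0..<card F}"
    using assms(1) ex_bij_betw_finite_nat by blast
  have inj: "inj_on r F" and im: "r ` F = {0..<card F}" using r by (auto simp: bij_betw_def)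
  have "card {h \<in> F. r h div D = c} \<le> D" for c
  proof -
    have "r ` {h \<in> F. r h div D = c} \<subseteq> {c*D..<c*D+D}"
    proof safe
      fix h
      show "r h \<in> {r h div D * D..<r h div D * D + D}"
        using mod_less_divisor[OF assms(2), of "r h"] div_mult_mod_eq[of "r h" D]
        unfolding atLeastLessThan_iff by linarith
    qed
    hence "card (r ` {h \<in> F. r h div D = c}) \<le> D"
      using card_mono[of "{c*D..<c*D+D}"] by fastforce
    thus ?thesis using inj by (subst (asm) card_image) (auto intro: inj_on_subset)
  qed
  moreover have "card ((\<lambda>h. r h div D) ` F) \<le> card F div D + 1"
  proof -
    have "(\<lambda>h. r h div D) ` F \<subseteq> {..card F div D}"
    proof safe
      fix h assume "h \<in> F"
      hence "r h < card F" using im by auto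
      thus "r h div D \<le> card F div D" by (simp add: div_le_mono)
    qed
    from card_mono[OF _ this] show ?thesis by simp
  qed
  ultimately show ?thesis using that[of "\<lambda>h. r h div D"] by blast
qed

text \<open>Each value \<open>v\<close> of the expanding map is split into copies
  \<open>(v, c)\<close>, each used by at most 16 slots. With 16N slots and N values this takes at
  most 16N/16 + N copies.\<close>

lemma exists_sparse_expander:
  fixes N :: nat
  assumes "N > 0"
  obtains a :: "nat \<Rightarrow> nat \<Rightarrow> nat \<times> nat" and W where
    "finite W" "card W \<le> 2 * N" "\<And>e i. e < 4*N \<Longrightarrow> i < 4 \<Longrightarrow> a e i \<in> W"
    "\<And>w. card {(e, i) \<in> {..<4*N} \<times> {..<4}. a e i = w} \<le> 16"
    "\<And>S. S \<subseteq> {..<4*N} \<Longrightarrow> S \<noteq> {} \<Longrightarrow> 1728 * card S \<le> N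
        \<Longrightarrow> card (case_prod a ` (S \<times> {..<4})) > 2 * card S"
proof -
  define I :: "(nat \<times> nat) set" where "I = {..<4*N} \<times> {..<4}"
  have finI: "finite I" and cardI: "card I = 16 * N" by (auto simp: I_def)
  obtain f where f: "f ` I \<subseteq> {..<N}"
    "\<And>S. S \<subseteq> {..<4*N} \<Longrightarrow> S \<noteq> {} \<Longrightarrow> 1728 * card S \<le> N
        \<Longrightarrow> card (f ` (S \<times> {..<4})) > 2 * card S"
    using exists_expanding_map[OF assms] unfolding I_def by metis
  define F where "F v = {h \<in> I. f h = v}" for v
  have finF: "finite (F v)" for v using finI by (simp add: F_def)
  have "\<exists>g :: nat \<times> nat \<Rightarrow> nat. (\<forall>c. card {h \<in> F v. g h = c} \<le> 16) \<and> card (g ` F v) \<le> card (F v) div 16 + 1" for v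
    by (rule split_into_small_fibres[OF finF[of v], of 16]) auto
  then obtain g :: "nat \<Rightarrow> nat \<times> nat \<Rightarrow> nat" where
    g: "\<And>v c. card {h \<in> F v. g v h = c} \<le> 16" "\<And>v. card (g v ` F v) \<le> card (F v) div 16 + 1"
    using that choice[of "\<lambda>v g. (\<forall>c. card {h \<in> F v. g h = c} \<le> 16) \<and> card (g ` F v) \<le> card (F v) div 16 + 1"]
    by blast
  define a where "a e i = (f (e, i), g (f (e, i)) (e, i))" for e i
  define W where "W = case_prod a ` I"
  have W_eq: "W = (SIGMA v:{..<N}. g v ` F v)"
    using f(1) by (force simp: W_def a_def F_def)
  have "card W = (\<Sum>v<N. card (g v ` F v))"
    unfolding W_eq using finF by (subst card_SigmaI) auto
  also have "\<dots> \<le> (\<Sum>v<N. card (F v) div 16 + 1)" by (intro sum_mono g)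
  also have "\<dots> \<le> (\<Sum>v<N. card (F v)) div 16 + N"
  proof -
    have "16 * (\<Sum>v<N. card (F v) div 16) \<le> (\<Sum>v<N. card (F v))"
      unfolding sum_distrib_left by (intro sum_mono) auto
    moreover have "(\<Sum>v<N. card (F v) div 16 + 1) = (\<Sum>v<N. card (F v) div 16) + N"
      by (simp only: sum.distrib) simp
    ultimately show ?thesis by linarith
  qed
  also have "(\<Sum>v<N. card (F v)) = card (\<Union>v\<in>{..<N}. F v)"
    using finF by (subst card_UN_disjoint) (auto simp: F_def)
  also have "(\<Union>v\<in>{..<N}. F v) = I" using f(1) by (auto simp: F_def)
  finally have "card W \<le> 2 * N" by (simp add: cardI)
  moreover have "card {(e, i) \<in> {..<4*N} \<times> {..<4}. a e i = w} \<le> 16" for w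
  proof -
    have "{(e, i) \<in> {..<4*N} \<times> {..<4}. a e i = w} = {h \<in> F (fst w). g (fst w) h = snd w}"
      by (auto simp: a_def F_def I_def)
    thus ?thesis using g(1) by simp
  qed
  moreover have "card (case_prod a ` (S \<times> {..<4})) > 2 * card S"
    if S: "S \<subseteq> {..<4*N}" "S \<noteq> {}" "1728 * card S \<le> N" for S
  proof -
    \<comment> \<open>Forgetting the copy index recovers the original map, so splitting cannot
      decrease the number of neighbours.\<close>
    have "f ` (S \<times> {..<4}) = fst ` case_prod a ` (S \<times> {..<4})"
      by (force simp: a_def)
    moreover have "finite S" using S(1) finite_subset by blast
    ultimately have "card (f ` (S \<times> {..<4})) \<le> card (case_prod a ` (S \<times> {..<4}))"
      by (metis card_image_le finite_SigmaI finite_imageI finite_lessThan)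
    thus ?thesis using f(2)[OF S] by linarith
  qed
  ultimately show ?thesis
    using finI that[of W a] by (auto simp: W_def I_def)
qed

section \<open>Limited independence of the right-hand sides\<close>

text \<open>An assignment is encoded as the set of variables with value 1. Slots are counted rather
  than variables, so a variable repeated in a row enters the sum with its multiplicity.\<close>

definition row_parity :: "(nat \<Rightarrow> nat \<Rightarrow> 'v) \<Rightarrow> 'v set \<Rightarrow> nat \<Rightarrow> bool" where
  "row_parity a X e \<longleftrightarrow> odd (card {i. i < 4 \<and> a e i \<in> X})"

lemma card_less_4: "card {i. i < (4::nat) \<and> P i} = of_bool (P 0) + of_bool (P 1) + of_bool (P 2) + of_bool (P 3)"
proof -
  have "{i. i < (4::nat) \<and> P i} = (\<Union>j\<in>{0,1,2,3}. if P j then {j} else {})"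
    by (auto split: if_splits simp: less_Suc_eq numeral_eq_Suc)
  also have "card \<dots> = (\<Sum>j\<in>{0,1,2,3}. card (if P j then {j} else {}))"
    by (rule card_UN_disjoint) auto
  finally show ?thesis by (simp add: if_distrib cong: if_cong)
qed

text \<open>Double counting: if every neighbour were hit by two slots, the 4|S| slots would have at
  most 2|S| neighbours. The slot itself is unique, not only the row, so that flipping its variable
  changes the parity of that row.\<close>

lemma unique_neighbour:
  fixes a :: "nat \<Rightarrow> nat \<Rightarrow> 'v"
  assumes "finite S" "card (case_prod a ` (S \<times> {..<4})) > 2 * card S"
  obtains e i where "e \<in> S" "i < 4"
    "\<And>e' i'. e' \<in> S \<Longrightarrow> i' < 4 \<Longrightarrow> a e' i' = a e i \<Longrightarrow> e' = e \<and> i' = i"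
proof -
  let ?I = "S \<times> {..<4::nat}" and ?f = "case_prod a"
  have "\<exists>v\<in>?f ` ?I. card {h \<in> ?I. ?f h = v} < 2"
  proof (rule ccontr)
    assume "\<not> ?thesis"
    hence "2 \<le> card {h \<in> ?I. ?f h = v}" if "v \<in> ?f ` ?I" for v using that by (meson not_less)
    hence "(\<Sum>v\<in>?f ` ?I. 2) \<le> (\<Sum>v\<in>?f ` ?I. card {h \<in> ?I. ?f h = v})" by (intro sum_mono)
    also have "\<dots> = card (\<Union>v\<in>?f ` ?I. {h \<in> ?I. ?f h = v})"
      using assms(1) by (subst card_UN_disjoint) auto
    also have "(\<Union>v\<in>?f ` ?I. {h \<in> ?I. ?f h = v}) = ?I" by auto
    finally show False using assms by (simp add: card_cartesian_product)
  qed
  then obtain e i where ei: "e \<in> S" "i < 4" "card {h \<in> ?I. ?f h = a e i} < 2" by auto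
  show ?thesis
  proof (rule that[OF ei(1,2)])
    fix e' i' assume *: "e' \<in> S" "i' < (4::nat)" "a e' i' = a e i"
    have "card {(e, i), (e', i')} \<le> card {h \<in> ?I. ?f h = a e i}"
      using * ei assms(1) by (intro card_mono) auto
    with ei(3) show "e' = e \<and> i' = i" by (cases "(e, i) = (e', i')") auto
  qed
qed

text \<open>Flipping the private variable of one row of \<open>R\<close> changes that row only, which halves the
  number of solutions with every row.\<close>

lemma card_row_parity_prescribed:
  fixes a :: "nat \<Rightarrow> nat \<Rightarrow> 'v"
  assumes W: "finite W" "\<And>e i. e \<in> M \<Longrightarrow> i < 4 \<Longrightarrow> a e i \<in> W"
    and expand: "\<And>S. S \<subseteq> M \<Longrightarrow> S \<noteq> {} \<Longrightarrow> card S \<le> r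
      \<Longrightarrow> card (case_prod a ` (S \<times> {..<4})) > 2 * card S"
  assumes R: "finite R" "R \<subseteq> M" "card R \<le> r"
  shows "card {X \<in> Pow W. \<forall>e\<in>R. row_parity a X e = (e \<in> \<beta>)} * 2 ^ card R = 2 ^ card W"
  using R
proof (induction "card R" arbitrary: R)
  case 0
  thus ?case using W by (simp add: card_Pow flip: Pow_def)
next
  case (Suc s)
  have "R \<noteq> {}" using Suc.hyps by auto
  then obtain e i where ei: "e \<in> R" "i < 4"
    "\<And>e' i'. e' \<in> R \<Longrightarrow> i' < 4 \<Longrightarrow> a e' i' = a e i \<Longrightarrow> e' = e \<and> i' = i"
    using unique_neighbour[OF Suc.prems(1) expand] Suc.prems by metis
  define w where "w = a e i"
  define R' where "R' = R - {e}"
  define sol where "sol p = {X \<in> Pow W. (\<forall>e\<in>R'. row_parity a X e = (e \<in> \<beta>)) \<and> row_parity a X e = p}" for p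
  define flip where "flip X = (if w \<in> X then X - {w} else insert w X)" for X
  have wW: "w \<in> W" using W(2) ei Suc.prems by (auto simp: w_def)
  have flip_flip: "flip (flip X) = X" for X by (auto simp: flip_def)
  have mem_flip: "v \<in> flip X \<longleftrightarrow> (v \<in> X) \<noteq> (v = w)" for v X by (auto simp: flip_def)
  have par_other: "row_parity a (flip X) e' = row_parity a X e'" if "e' \<in> R'" for e' X
  proof -
    have "{i. i < 4 \<and> a e' i \<in> flip X} = {i. i < 4 \<and> a e' i \<in> X}"
      using that ei unfolding mem_flip w_def R'_def by blast
    thus ?thesis by (simp add: row_parity_def)
  qed
  have par_e: "row_parity a (flip X) e \<longleftrightarrow> \<not> row_parity a X e" for X
  proof -
    have *: "a e j = w \<longleftrightarrow> j = i" if "j < 4" for j using that ei unfolding w_def by blast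
    have i: "i = 0 \<or> i = 1 \<or> i = 2 \<or> i = 3" using ei(2) by auto
    have "(a e j \<in> flip X) = ((a e j \<in> X) \<noteq> (j = i))" if "j < 4" for j
      using *[OF that] by (simp add: mem_flip)
    from this[of 0] this[of 1] this[of 2] this[of 3] i show ?thesis
      unfolding row_parity_def card_less_4
      by (elim disjE; simp; cases "a e 0 \<in> X"; cases "a e 1 \<in> X"; cases "a e 2 \<in> X"; cases "a e 3 \<in> X"; simp)
  qed
  have "flip ` sol p \<subseteq> sol (\<not> p)" for p
  proof safe
    fix X assume "X \<in> sol p"
    moreover have "flip X \<subseteq> W" if "X \<subseteq> W" using that wW by (auto simp: flip_def)
    ultimately show "flip X \<in> sol (\<not> p)"
      using par_other par_e by (simp add: sol_def)
  qed
  \<comment> \<open>\<open>flip\<close> is an involution, hence injective; the inequality for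
    \<open>p\<close> and for its negation gives equality.\<close>
  hence half_le: "card (sol p) \<le> card (sol (\<not> p))" for p
    using W(1) by (intro card_inj_on_le[of flip] inj_on_inverseI[of _ flip]) (auto simp: sol_def flip_flip)
  have half: "card (sol p) = card (sol (\<not> p))" for p
    using half_le[of p] half_le[of "\<not> p"] unfolding not_not by (rule le_antisym)
  have fin: "finite (sol p)" for p using W(1) by (simp add: sol_def)
  have R'_card: "card R' = s" using Suc.hyps Suc.prems ei by (simp add: R'_def)
  have "{X \<in> Pow W. \<forall>e\<in>R'. row_parity a X e = (e \<in> \<beta>)} = sol True \<union> sol False"
    by (auto simp: sol_def)
  also have "card \<dots> = card (sol True) + card (sol False)"
    by (rule card_Un_disjoint[OF fin fin]) (auto simp: sol_def)
  also have "\<dots> = 2 * card (sol (e \<in> \<beta>))" using half[of True] half[of False] by (cases "e \<in> \<beta>") auto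
  finally have "2 * card (sol (e \<in> \<beta>)) * 2 ^ s = 2 ^ card W"
    using Suc.hyps(1)[of R'] Suc.prems Suc.hyps(2) R'_card by (simp add: R'_def subset_iff)
  moreover have "{X \<in> Pow W. \<forall>e\<in>R. row_parity a X e = (e \<in> \<beta>)} = sol (e \<in> \<beta>)"
    using ei(1) by (auto simp: sol_def R'_def)
  ultimately show ?case using Suc.hyps(2) by (simp add: mult_ac flip: Suc.hyps(2))
qed

section \<open>Decision trees and limited independence\<close>

lemma card_Collect_partition:
  assumes "finite A" "finite G" "\<And>x. x \<in> A \<Longrightarrow> P x \<Longrightarrow> h x \<in> G"
  shows "card {x \<in> A. P x} = (\<Sum>\<gamma>\<in>G. card {x \<in> A. P x \<and> h x = \<gamma>})"
proof -
  have "{x \<in> A. P x} = (\<Union>\<gamma>\<in>G. {x \<in> A. P x \<and> h x = \<gamma>})" using assms(3) by auto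
  also have "card \<dots> = (\<Sum>\<gamma>\<in>G. card {x \<in> A. P x \<and> h x = \<gamma>})"
    using assms by (subst card_UN_disjoint) auto
  finally show ?thesis .
qed

text \<open>Cross-multiplied form of: the random set \<open>g X\<close> for uniform \<open>X \<in> \<Omega>\<close> and the uniform random
  subset of \<open>M\<close> are accepted with the same probability. Any \<open>r\<close> membership bits of \<open>g X\<close> are
  uniform, and each answer depends on at most \<open>D\<close> of them.\<close>

lemma decision_tree_fooled_conditional:
  fixes acc :: "'b set \<Rightarrow> nat \<Rightarrow> nat \<Rightarrow> nat set option"
  assumes M: "finite M" and \<Omega>: "finite \<Omega>" and g: "\<And>X. X \<in> \<Omega> \<Longrightarrow> g X \<subseteq> M"
    and unif: "\<And>R \<beta>. R \<subseteq> M \<Longrightarrow> card R \<le> r \<Longrightarrow> card {X \<in> \<Omega>. g X \<inter> R = \<beta> \<inter> R} * 2 ^ card R = card \<Omega>"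
    and local: "\<And>B B' i j. B \<subseteq> M \<Longrightarrow> B' \<subseteq> M \<Longrightarrow> B \<inter> touch i = B' \<inter> touch i \<Longrightarrow> acc B i j = acc B' i j"
    and touch: "\<And>i. touch i \<subseteq> M" "\<And>i. card (touch i) \<le> D"
  assumes "R \<subseteq> M" "card R + D * q \<le> r"
    and "\<And>B. B \<subseteq> M \<Longrightarrow> B \<inter> R = \<beta> \<inter> R \<Longrightarrow> num_queries (acc B) t \<le> q"
  shows "card {X \<in> \<Omega>. g X \<inter> R = \<beta> \<inter> R \<and> accepts (acc (g X)) t} * 2 ^ card M
       = card {B \<in> Pow M. B \<inter> R = \<beta> \<inter> R \<and> accepts (acc B) t} * card \<Omega>"
  using assms(8-)
proof (induction t arbitrary: R \<beta> q)
  case (Decide b)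
  \<comment> \<open>At a leaf the verdict is constant, so both sides only count agreement with
    \<open>\<beta>\<close> on \<open>R\<close>. For a uniform subset of \<open>M\<close> the
    elements outside \<open>R\<close> are free.\<close>
  have "bij_betw (\<lambda>B. B - R) {B \<in> Pow M. B \<inter> R = \<beta> \<inter> R} (Pow (M - R))"
    by (rule bij_betwI[where g="\<lambda>C. C \<union> (\<beta> \<inter> R)"]) (use Decide in auto)
  hence "card {B \<in> Pow M. B \<inter> R = \<beta> \<inter> R} = 2 ^ card (M - R)"
    using M by (simp add: bij_betw_same_card card_Pow)
  also have "\<dots> * 2 ^ card R = 2 ^ card M"
    using Decide M card_mono[OF M] finite_subset[of R M]
    by (simp add: card_Diff_subset flip: power_add)
  finally have B: "card {B \<in> Pow M. B \<inter> R = \<beta> \<inter> R} * 2 ^ card R = 2 ^ card M" .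
  have X: "card {X \<in> \<Omega>. g X \<inter> R = \<beta> \<inter> R} * 2 ^ card R = card \<Omega>"
    using unif[of R \<beta>] Decide by simp
  have "card {X \<in> \<Omega>. g X \<inter> R = \<beta> \<inter> R} * 2 ^ card M
       = card {B \<in> Pow M. B \<inter> R = \<beta> \<inter> R} * card \<Omega>"
    unfolding B[symmetric] X[symmetric] by (simp only: mult_ac)
  thus ?case by (cases b) auto
next
  case (Query i j f)
  \<comment> \<open>One right-hand side consistent with \<open>\<beta>\<close> suffices to see that
    the budget \<open>q\<close> is positive.\<close>
  have "num_queries (acc (\<beta> \<inter> R)) (Query i j f) \<le> q"
    using Query.prems(1) by (intro Query.prems(3)) auto
  then obtain q' where q: "q = Suc q'" by (cases q) auto
  \<comment> \<open>All bits that the answer may depend on are revealed at once, at a cost of at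
    most \<open>D\<close>. Both counts are then split by the revealed pattern in \<open>G\<close>,
    under which the answer is constant.\<close>
  define R' where "R' = R \<union> touch i"
  have R': "R' \<subseteq> M" using Query.prems(1) touch by (auto simp: R'_def)
  have finR': "finite R'" using R' M finite_subset by blast
  have cR': "card R' + D * q' \<le> r"
    using card_Un_le[of R "touch i"] touch(2)[of i] Query.prems(2) unfolding q R'_def
    by simp
  define G where "G = {\<gamma> \<in> Pow R'. \<gamma> \<inter> R = \<beta> \<inter> R}"
  have finG: "finite G" using finR' by (simp add: G_def)
  have IH: "card {X \<in> \<Omega>. (g X \<inter> R = \<beta> \<inter> R \<and> accepts (acc (g X)) (Query i j f)) \<and> g X \<inter> R' = \<gamma>} * 2 ^ card M
       = card {B \<in> Pow M. (B \<inter> R = \<beta> \<inter> R \<and> accepts (acc B) (Query i j f)) \<and> B \<inter> R' = \<gamma>} * card \<Omega>"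
    if \<gamma>: "\<gamma> \<in> G" for \<gamma>
  proof -
    let ?t = "f (acc \<gamma> i j)"
    have \<gamma>M: "\<gamma> \<subseteq> M" and \<gamma>R': "\<gamma> \<inter> R' = \<gamma>" using \<gamma> R' by (auto simp: G_def)
    have acc_eq: "acc B i j = acc \<gamma> i j" if "B \<subseteq> M" "B \<inter> R' = \<gamma>" for B
      using that \<gamma>M by (intro local) (auto simp: R'_def)
    have R_eq: "B \<inter> R = \<beta> \<inter> R" if "B \<inter> R' = \<gamma>" for B
      using that \<gamma> by (auto simp: G_def R'_def)
    have "card {X \<in> \<Omega>. g X \<inter> R' = \<gamma> \<inter> R' \<and> accepts (acc (g X)) ?t} * 2 ^ card M
       = card {B \<in> Pow M. B \<inter> R' = \<gamma> \<inter> R' \<and> accepts (acc B) ?t} * card \<Omega>"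
    proof (rule Query.IH[OF _ R' cR'])
      fix B assume B: "B \<subseteq> M" "B \<inter> R' = \<gamma> \<inter> R'"
      hence "num_queries (acc B) (Query i j f) \<le> q" using R_eq[of B] \<gamma>R' by (intro Query.prems) auto
      thus "num_queries (acc B) ?t \<le> q'" using acc_eq[of B] B \<gamma>R' by (simp add: q)
    qed auto
    moreover have "{X \<in> \<Omega>. g X \<inter> R' = \<gamma> \<inter> R' \<and> accepts (acc (g X)) ?t}
      = {X \<in> \<Omega>. (g X \<inter> R = \<beta> \<inter> R \<and> accepts (acc (g X)) (Query i j f)) \<and> g X \<inter> R' = \<gamma>}"
    proof (rule Collect_cong, rule conj_cong[OF refl])
      fix X assume "X \<in> \<Omega>"
      thus "(g X \<inter> R' = \<gamma> \<inter> R' \<and> accepts (acc (g X)) ?t)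
        = ((g X \<inter> R = \<beta> \<inter> R \<and> accepts (acc (g X)) (Query i j f)) \<and> g X \<inter> R' = \<gamma>)"
        using acc_eq[OF g] R_eq[of "g X"] unfolding \<gamma>R' by auto
    qed
    moreover have "{B \<in> Pow M. B \<inter> R' = \<gamma> \<inter> R' \<and> accepts (acc B) ?t}
      = {B \<in> Pow M. (B \<inter> R = \<beta> \<inter> R \<and> accepts (acc B) (Query i j f)) \<and> B \<inter> R' = \<gamma>}"
    proof (rule Collect_cong, rule conj_cong[OF refl])
      fix B assume "B \<in> Pow M"
      thus "(B \<inter> R' = \<gamma> \<inter> R' \<and> accepts (acc B) ?t)
        = ((B \<inter> R = \<beta> \<inter> R \<and> accepts (acc B) (Query i j f)) \<and> B \<inter> R' = \<gamma>)"
        using acc_eq[of B] R_eq[of B] unfolding \<gamma>R' by auto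
    qed
    ultimately show ?thesis by simp
  qed
  have "card {X \<in> \<Omega>. g X \<inter> R = \<beta> \<inter> R \<and> accepts (acc (g X)) (Query i j f)}
    = (\<Sum>\<gamma>\<in>G. card {X \<in> \<Omega>. (g X \<inter> R = \<beta> \<inter> R \<and> accepts (acc (g X)) (Query i j f)) \<and> g X \<inter> R' = \<gamma>})"
    using \<Omega> finG by (intro card_Collect_partition) (auto simp: G_def R'_def)
  moreover have "card {B \<in> Pow M. B \<inter> R = \<beta> \<inter> R \<and> accepts (acc B) (Query i j f)}
    = (\<Sum>\<gamma>\<in>G. card {B \<in> Pow M. (B \<inter> R = \<beta> \<inter> R \<and> accepts (acc B) (Query i j f)) \<and> B \<inter> R' = \<gamma>})"
    using M finG by (intro card_Collect_partition) (auto simp: G_def R'_def)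
  ultimately show ?case using IH by (simp only: sum_distrib_right cong: sum.cong)
qed

lemma decision_tree_fooled:
  fixes acc :: "'b set \<Rightarrow> nat \<Rightarrow> nat \<Rightarrow> nat set option"
  assumes "finite M" "finite \<Omega>" "\<And>X. X \<in> \<Omega> \<Longrightarrow> g X \<subseteq> M"
    and "\<And>R \<beta>. R \<subseteq> M \<Longrightarrow> card R \<le> r \<Longrightarrow> card {X \<in> \<Omega>. g X \<inter> R = \<beta> \<inter> R} * 2 ^ card R = card \<Omega>"
    and "\<And>B B' i j. B \<subseteq> M \<Longrightarrow> B' \<subseteq> M \<Longrightarrow> B \<inter> touch i = B' \<inter> touch i \<Longrightarrow> acc B i j = acc B' i j"
    and "\<And>i. touch i \<subseteq> M" "\<And>i. card (touch i) \<le> D"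
    and "D * q \<le> r" "\<And>B. B \<subseteq> M \<Longrightarrow> num_queries (acc B) t \<le> q"
  shows "card {X \<in> \<Omega>. accepts (acc (g X)) t} * 2 ^ card M
       = card {B \<in> Pow M. accepts (acc B) t} * card \<Omega>"
proof -
  have "card {X \<in> \<Omega>. g X \<inter> {} = {} \<inter> {} \<and> accepts (acc (g X)) t} * 2 ^ card M
       = card {B \<in> Pow M. B \<inter> {} = {} \<inter> {} \<and> accepts (acc B) t} * card \<Omega>"
    by (rule decision_tree_fooled_conditional[where touch=touch and r=r and D=D and q=q])
      (fact assms | simp add: assms(8,9))+
  thus ?thesis by simp
qed

text \<open>Linearity of expectation exchanges the average over inputs with the random choice of the
  tree, so that identities for single trees carry over to randomized algorithms.\<close>

lemma sum_prob_eq_expectation_card: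
  assumes "finite A"
  shows "(\<Sum>x\<in>A. measure_pmf.prob T {t. P x t}) = measure_pmf.expectation T (\<lambda>t. real (card {x \<in> A. P x t}))"
proof -
  have "measure_pmf.expectation T (\<lambda>t. real (card {x \<in> A. P x t}))
     = measure_pmf.expectation T (\<lambda>t. \<Sum>x\<in>A. indicator {t. P x t} t)"
    using assms by (simp add: indicator_def sum.If_cases Int_def)
  also have "\<dots> = (\<Sum>x\<in>A. measure_pmf.expectation T (indicator {t. P x t}))"
    by (intro Bochner_Integration.integral_sum) (simp add: measure_pmf.integrable_const_bound[where B=1])
  finally show ?thesis by simp
qed

lemma tester_fooled:
  fixes acc :: "'b set \<Rightarrow> nat \<Rightarrow> nat \<Rightarrow> nat set option"
  assumes "finite M" "finite \<Omega>" "\<And>X. X \<in> \<Omega> \<Longrightarrow> g X \<subseteq> M"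
    and "\<And>R \<beta>. R \<subseteq> M \<Longrightarrow> card R \<le> r \<Longrightarrow> card {X \<in> \<Omega>. g X \<inter> R = \<beta> \<inter> R} * 2 ^ card R = card \<Omega>"
    and "\<And>B B' i j. B \<subseteq> M \<Longrightarrow> B' \<subseteq> M \<Longrightarrow> B \<inter> touch i = B' \<inter> touch i \<Longrightarrow> acc B i j = acc B' i j"
    and "\<And>i. touch i \<subseteq> M" "\<And>i. card (touch i) \<le> D"
    and "D * q \<le> r" "\<And>B t. B \<subseteq> M \<Longrightarrow> t \<in> set_pmf T \<Longrightarrow> num_queries (acc B) t \<le> q"
  shows "(\<Sum>X\<in>\<Omega>. measure_pmf.prob T {t. accepts (acc (g X)) t}) * 2 ^ card M
       = (\<Sum>B\<in>Pow M. measure_pmf.prob T {t. accepts (acc B) t}) * real (card \<Omega>)"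
proof -
  have "(\<Sum>X\<in>\<Omega>. measure_pmf.prob T {t. accepts (acc (g X)) t}) * 2 ^ card M
     = measure_pmf.expectation T (\<lambda>t. real (card {X \<in> \<Omega>. accepts (acc (g X)) t}) * 2 ^ card M)"
    using assms(2) by (simp add: sum_prob_eq_expectation_card)
  also have "\<dots> = measure_pmf.expectation T (\<lambda>t. real (card {B \<in> Pow M. accepts (acc B) t}) * real (card \<Omega>))"
  proof (intro integral_cong_AE)
    show "AE t in measure_pmf T. real (card {X \<in> \<Omega>. accepts (acc (g X)) t}) * 2 ^ card M
      = real (card {B \<in> Pow M. accepts (acc B) t}) * real (card \<Omega>)"
    proof (rule AE_pmfI)
      fix t assume "t \<in> set_pmf T"
      hence "card {X \<in> \<Omega>. accepts (acc (g X)) t} * 2 ^ card M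
        = card {B \<in> Pow M. accepts (acc B) t} * card \<Omega>"
        by (intro decision_tree_fooled[where touch=touch and r=r and D=D and q=q] assms)
      thus "real (card {X \<in> \<Omega>. accepts (acc (g X)) t}) * 2 ^ card M
        = real (card {B \<in> Pow M. accepts (acc B) t}) * real (card \<Omega>)"
        by (metis (mono_tags) of_nat_mult of_nat_numeral of_nat_power)
    qed
  qed auto
  also have "\<dots> = (\<Sum>B\<in>Pow M. measure_pmf.prob T {t. accepts (acc B) t}) * real (card \<Omega>)"
    using assms(1) by (simp add: sum_prob_eq_expectation_card)
  finally show ?thesis .
qed

section \<open>Right-hand sides close to satisfiable ones\<close>

text \<open>Chernoff-type count: give \<open>B\<close> the weight z^|B|. All weights sum to (1 +
  z)^|M|, and a set of at most s elements weighs at least z^s.\<close>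

lemma card_small_subsets_le:
  assumes "finite M" "0 < z" "z \<le> 1"
  shows "real (card {B \<in> Pow M. card B \<le> s}) \<le> (1 + z) ^ card M / z ^ s"
proof -
  have fin: "finite (Pow M)" using assms by simp
  have "(\<Prod>x\<in>M. 1 + z) = (\<Sum>B\<in>Pow M. (\<Prod>x\<in>M - B. 1) * (\<Prod>x\<in>B. z))"
    using prod_add[OF assms(1), of "\<lambda>_. z" "\<lambda>_. 1"] by (simp add: add.commute mult.commute)
  hence "(1 + z) ^ card M = (\<Sum>B\<in>Pow M. z ^ card B)" by simp
  also have "\<dots> \<ge> (\<Sum>B\<in>{B \<in> Pow M. card B \<le> s}. z ^ card B)"
    using assms fin by (intro sum_mono2) auto
  moreover have "(\<Sum>B\<in>{B \<in> Pow M. card B \<le> s}. z ^ card B) \<ge> (\<Sum>B\<in>{B \<in> Pow M. card B \<le> s}. z ^ s)"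
    using assms by (intro sum_mono power_decreasing) auto
  ultimately have "real (card {B \<in> Pow M. card B \<le> s}) * z ^ s \<le> (1 + z) ^ card M" by simp
  thus ?thesis using assms by (simp add: field_simps)
qed

text \<open>Union bound over the Hamming balls of radius \<open>s\<close> around the points
  \<open>g X\<close>, with ball sizes estimated at z = 1/8.\<close>

lemma card_near_image_le:
  assumes "N \<ge> 3" "card M = 4 * N" "6 * s \<le> N" "finite \<Omega>" "card \<Omega> \<le> 2 ^ (2 * N)"
    and g: "\<And>X. X \<in> \<Omega> \<Longrightarrow> g X \<subseteq> M"
  shows "4 * card {B \<in> Pow M. \<exists>X\<in>\<Omega>. card (sym_diff B (g X)) \<le> s} \<le> 2 ^ (4 * N)"
proof -
  have finM: "finite M" using assms(1,2) by (auto intro: card_ge_0_finite)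
  let ?near = "{B \<in> Pow M. \<exists>X\<in>\<Omega>. card (sym_diff B (g X)) \<le> s}"
  let ?small = "{C \<in> Pow M. card C \<le> s}"
  have fin: "finite ?small" using finM by simp
  have "?near \<subseteq> (\<lambda>(X, C). sym_diff (g X) C) ` (\<Omega> \<times> ?small)"
  proof safe
    fix B X assume B: "B \<subseteq> M" "X \<in> \<Omega>" "card (sym_diff B (g X)) \<le> s"
    have "B = sym_diff (g X) (sym_diff B (g X))" by blast
    moreover have "sym_diff B (g X) \<in> ?small" using B g[of X] by auto
    ultimately show "B \<in> (\<lambda>(X, C). sym_diff (g X) C) ` (\<Omega> \<times> ?small)"
      using B(2) by (intro image_eqI[of _ _ "(X, sym_diff B (g X))"]) auto
  qed
  from surj_card_le[OF _ this] have "card ?near \<le> card (\<Omega> \<times> ?small)"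
    using assms(4) fin by simp
  hence "real (card ?near) \<le> real (card \<Omega>) * real (card ?small)"
    unfolding card_cartesian_product of_nat_mult[symmetric] of_nat_le_iff .
  also have "\<dots> \<le> 2 ^ (2 * N) * ((1 + 1/8) ^ (4 * N) / (1/8) ^ s)"
  proof (intro mult_mono)
    have "real (card \<Omega>) \<le> real (2 ^ (2 * N))" using assms(5) by (simp only: of_nat_le_iff)
    thus "real (card \<Omega>) \<le> 2 ^ (2 * N)" by simp
    show "real (card ?small) \<le> (1 + 1/8) ^ (4 * N) / (1/8) ^ s"
      using card_small_subsets_le[OF finM, of "1/8" s] assms(2) by simp
  qed auto
  also have "\<dots> = (4 * (9/8)^4) ^ N * 8 ^ s"
  proof -
    have "(1 + 1/8 :: real) ^ (4 * N) = ((9/8)^4) ^ N" "(2::real) ^ (2 * N) = 4 ^ N"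
      by (simp_all only: power_mult) simp_all
    thus ?thesis by (simp only: power_mult_distrib) (simp add: power_one_over)
  qed
  also have "\<dots> \<le> (4 * (9/8)^4) ^ N * (36/25) ^ N"
  proof (intro mult_left_mono)
    \<comment> \<open>(36/25)^6 is about 8.9; the exponent 6 matches
      \<open>6 * s \<le> N\<close>.\<close>
    have "(8::real) ^ s \<le> ((36/25) ^ 6) ^ s" by (intro power_mono) (auto simp: power_divide)
    also have "\<dots> \<le> (36/25) ^ N" using assms(3) by (simp add: power_increasing flip: power_mult)
    finally show "(8::real) ^ s \<le> (36/25) ^ N" .
  qed auto
  also have "\<dots> = 16 ^ N * ((9/8)^4 * (36/25) / 4) ^ N"
    unfolding power_mult_distrib[symmetric]
    by (rule arg_cong[where f="\<lambda>x. x ^ N"]) (simp add: power_divide)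
  \<comment> \<open>The base is about 0.577, and its cube is below 1/4.\<close>
  also have "\<dots> \<le> 16 ^ N * ((9/8)^4 * (36/25) / 4) ^ 3"
    using assms(1) by (intro mult_left_mono power_decreasing) (auto simp: power_divide)
  also have "\<dots> \<le> 16 ^ N * (1/4)" by (intro mult_left_mono) (auto simp: power_divide)
  finally have "4 * real (card ?near) \<le> 16 ^ N" by simp
  moreover have "(2::real) ^ (4 * N) = 16 ^ N" by (simp add: power_mult)
  ultimately have "real (4 * card ?near) \<le> real (2 ^ (4 * N))" by simp
  thus ?thesis by (simp only: of_nat_le_iff)
qed

section \<open>The parity gadget\<close>

text \<open>A variable \<open>v\<close> is a pair of vertices \<open>Var v False\<close>, \<open>Var v True\<close>, and its value is the order of
  their two colours. In the gadget of row \<open>e\<close>, the edges \<open>pair_edge\<close> force each of the four pairs to carry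
  the two colours missing on the palette \<open>Pal 3, \<dots>, Pal k\<close>. On such pairs, the parity is \<open>b\<close> iff for
  no \<open>j < 4\<close> the literals \<open>lit a e b j 0, \<dots>, lit a e b j 3\<close> all have the same colour: up to
  exchanging the two colours, an assignment of wrong parity flips exactly one literal. The vertices
  \<open>Tri j i\<close> and \<open>Mid j s\<close> exclude this: \<open>Tri j i\<close> avoids the colour of literal \<open>i\<close>, so a common colour
  of literals 0 and 1 is forced on \<open>Mid j False\<close>, a common colour of literals 2 and 3 on
  \<open>Mid j True\<close>, and these two must differ. The \<open>Fill\<close> vertices only pad edges to size \<open>k\<close>. All this is invariant
  under permutations of the colours, so no palette has to be shared between gadgets.\<close>

datatype aux = Pal nat | Tri nat nat | Mid nat bool | Fill nat nat nat
datatype 'v vertex = Var 'v bool | Aux nat aux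

text \<open>The second index of \<open>Fill\<close> is 0 to 3 for the literal edges and 4 for
  \<open>mid_edge\<close>, so padded edges do not share fillers.\<close>

definition aux_vertices :: "nat \<Rightarrow> aux set" where
  "aux_vertices k = Pal ` {3..k} \<union> case_prod Tri ` ({..<4} \<times> {..<4}) \<union> case_prod Mid ` ({..<4} \<times> UNIV)
     \<union> (\<lambda>(j, i, c). Fill j i c) ` ({..<4} \<times> {..4} \<times> {3..k})"

text \<open>The odd 0-1 vectors of length 4 are the unit vectors and their complements. Equal
  colours on all four literals mean that the values form the \<open>j\<close>-th of these, up to
  complement; for \<open>b\<close> true, slot 0 is flipped in addition, so that the excluded vectors
  are the even ones.\<close>

definition lit :: "(nat \<Rightarrow> nat \<Rightarrow> 'v) \<Rightarrow> nat \<Rightarrow> bool \<Rightarrow> nat \<Rightarrow> nat \<Rightarrow> 'v vertex" where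
  "lit a e b j i = Var (a e i) ((i = j) \<noteq> (b \<and> i = 0))"

definition pair_edge :: "nat \<Rightarrow> (nat \<Rightarrow> nat \<Rightarrow> 'v) \<Rightarrow> nat \<Rightarrow> nat \<Rightarrow> 'v vertex set" where
  "pair_edge k a e i = {Var (a e i) False, Var (a e i) True} \<union> (\<lambda>c. Aux e (Pal c)) ` {3..k}"

definition lit_edge :: "nat \<Rightarrow> (nat \<Rightarrow> nat \<Rightarrow> 'v) \<Rightarrow> nat \<Rightarrow> bool \<Rightarrow> nat \<Rightarrow> nat \<Rightarrow> 'v vertex set" where
  "lit_edge k a e b j i = {Aux e (Tri j i), lit a e b j i} \<union> (\<lambda>c. Aux e (Fill j i c)) ` {3..k}"

text \<open>The palette starts at 4 here: the two colours of the pairs and that of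
  \<open>Pal 3\<close> remain for the three other vertices.\<close>

definition tri_edge :: "nat \<Rightarrow> nat \<Rightarrow> nat \<Rightarrow> bool \<Rightarrow> 'v vertex set" where
  "tri_edge k e j s = {Aux e (Tri j (if s then 2 else 0)), Aux e (Tri j (if s then 3 else 1)), Aux e (Mid j s)}
     \<union> (\<lambda>c. Aux e (Pal c)) ` {4..k}"

definition mid_edge :: "nat \<Rightarrow> nat \<Rightarrow> nat \<Rightarrow> 'v vertex set" where
  "mid_edge k e j = {Aux e (Mid j False), Aux e (Mid j True)} \<union> (\<lambda>c. Aux e (Fill j 4 c)) ` {3..k}"

definition gadget :: "nat \<Rightarrow> (nat \<Rightarrow> nat \<Rightarrow> 'v) \<Rightarrow> nat \<Rightarrow> bool \<Rightarrow> 'v vertex set set" where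
  "gadget k a e b = pair_edge k a e ` {..<4} \<union> case_prod (lit_edge k a e b) ` ({..<4} \<times> {..<4})
     \<union> case_prod (tri_edge k e) ` ({..<4} \<times> UNIV) \<union> mid_edge k e ` {..<4}"

lemma finite_aux_vertices: "finite (aux_vertices k)"
  by (simp add: aux_vertices_def)

lemma finite_gadget: "finite (gadget k a e b)"
  by (simp add: gadget_def)

lemma card_gadget: "card (gadget k a e b) \<le> 32"
proof -
  have "card (gadget k a e b) \<le> card (pair_edge k a e ` {..<4}) + card (case_prod (lit_edge k a e b) ` ({..<4} \<times> {..<4}))
     + card (case_prod (tri_edge k e) ` ({..<4::nat} \<times> UNIV) :: 'a vertex set set)
     + card (mid_edge k e ` {..<4} :: 'a vertex set set)"
    unfolding gadget_def by (intro order.trans[OF card_Un_le] add_mono order_refl)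
  also have "\<dots> \<le> 4 + 16 + 8 + 4"
    by (intro add_mono order.trans[OF card_image_le]) (auto simp: card_cartesian_product)
  finally show ?thesis by simp
qed

text \<open>The bound \<open>k + 1\<close> admits an empty range, which occurs in
  \<open>tri_edge\<close> for k = 3.\<close>

lemma card_Un_image_nat:
  assumes "inj_on f {c..k}" "finite A" "A \<inter> f ` {c..k} = {}" "card A + 1 = c" "c \<le> k + 1"
  shows "card (A \<union> f ` {c..k::nat}) = k"
  using assms by (subst card_Un_disjoint) (auto simp: card_image)

lemma card_gadget_edge:
  assumes "k \<ge> 3" "E \<in> gadget k a e b"
  shows "card E = k"
proof -
  have "card (pair_edge k a e i) = k" for i
    unfolding pair_edge_def using assms(1) by (intro card_Un_image_nat) (auto simp: inj_on_def)
  moreover have "card (lit_edge k a e b j i) = k" for j i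
    unfolding lit_edge_def using assms(1) by (intro card_Un_image_nat) (auto simp: inj_on_def lit_def)
  moreover have "card (tri_edge k e j s :: 'a vertex set) = k" for j s
    unfolding tri_edge_def using assms(1) by (intro card_Un_image_nat) (auto simp: inj_on_def)
  moreover have "card (mid_edge k e j :: 'a vertex set) = k" for j
    unfolding mid_edge_def using assms(1) by (intro card_Un_image_nat) (auto simp: inj_on_def)
  ultimately show ?thesis using assms(2) by (auto simp: gadget_def)
qed

lemma gadget_edge_subset:
  assumes "E \<in> gadget k a e b"
  shows "E \<subseteq> case_prod Var ` (a e ` {..<4} \<times> UNIV) \<union> Aux e ` aux_vertices k"
proof -
  have aux: "c \<in> {3..k} \<Longrightarrow> Pal c \<in> aux_vertices k" "j < 4 \<Longrightarrow> i < 4 \<Longrightarrow> Tri j i \<in> aux_vertices k"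
    "j < 4 \<Longrightarrow> Mid j s \<in> aux_vertices k" "j < 4 \<Longrightarrow> i \<le> 4 \<Longrightarrow> c \<in> {3..k} \<Longrightarrow> Fill j i c \<in> aux_vertices k"
    for c j i s
    by (auto simp: aux_vertices_def intro!: image_eqI[of _ _ "(j, i)"] image_eqI[of _ _ "(j, s)"] image_eqI[of _ _ "(j, i, c)"])
  have var: "i < 4 \<Longrightarrow> Var (a e i) s \<in> case_prod Var ` (a e ` {..<4} \<times> UNIV)" for i s
    by (intro image_eqI[of _ _ "(a e i, s)"]) auto
  let ?V = "case_prod Var ` (a e ` {..<4} \<times> UNIV) \<union> Aux e ` aux_vertices k"
  have 1: "pair_edge k a e i \<subseteq> ?V" if "i < 4" for i
    using that aux var unfolding pair_edge_def by fast
  have 2: "lit_edge k a e b j i \<subseteq> ?V" if "j < 4" "i < 4" for j i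
    using that aux(2)[of j i] aux(4)[of j i] var[of i] unfolding lit_edge_def lit_def by auto
  have 3: "tri_edge k e j s \<subseteq> ?V" if "j < 4" for j s
  proof -
    have "c \<in> {4..k} \<Longrightarrow> Aux e (Pal c) \<in> ?V" "i < 4 \<Longrightarrow> Aux e (Tri j i) \<in> ?V" "Aux e (Mid j s) \<in> ?V" for c i
      using that aux by auto
    from this(1) this(2)[of 0] this(2)[of 1] this(2)[of 2] this(2)[of 3] this(3) show ?thesis
      unfolding tri_edge_def Un_subset_iff image_subset_iff by simp
  qed
  have 4: "mid_edge k e j \<subseteq> ?V" if "j < 4" for j
    using that aux unfolding mid_edge_def by auto
  from assms consider i where "E = pair_edge k a e i" "i < 4" | j i where "E = lit_edge k a e b j i" "j < 4" "i < 4"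
    | j s where "E = tri_edge k e j s" "j < 4" | j where "E = mid_edge k e j" "j < 4"
    by (auto simp: gadget_def)
  thus ?thesis by cases (simp_all only: 1 2 3 4)
qed

text \<open>Auxiliary vertices carry their row, so each edge determines the gadget it belongs to. In
  \<open>pair_edge\<close> they are palette vertices, which exist since
  \<open>k \<ge> 3\<close>.\<close>

lemma gadget_edge_has_aux:
  assumes "k \<ge> 3" "E \<in> gadget k a e b"
  obtains x where "x \<in> aux_vertices k" "Aux e x \<in> E"
proof -
  have "\<exists>x. Aux e x \<in> E"
    using assms(2) unfolding gadget_def
  proof (elim UnE imageE; clarsimp)
    show "\<exists>x. Aux e x \<in> pair_edge k a e i" for i
      using assms(1) by (auto simp: pair_edge_def intro!: exI[of _ "Pal 3"])
    show "\<exists>x. Aux e x \<in> lit_edge k a e b j i" for j i by (auto simp: lit_edge_def)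
    show "\<exists>x. Aux e x \<in> tri_edge k e j s" for j s by (auto simp: tri_edge_def)
    show "\<exists>x. Aux e x \<in> mid_edge k e j" for j by (auto simp: mid_edge_def)
  qed
  then obtain x where x: "Aux e x \<in> E" by blast
  with gadget_edge_subset[OF assms(2)] have "x \<in> aux_vertices k" by auto
  thus ?thesis using x that by blast
qed

section \<open>Soundness and completeness of the gadget\<close>

lemma rainbow_edge_full:
  assumes "inj_on c E" "c ` E \<subseteq> {1..k}" "card E = k" "k > 0"
  shows "c ` E = {1..k::nat}"
  using assms by (intro card_subset_eq) (auto simp: card_image)

lemma gadget_sound:
  fixes c :: "'v vertex \<Rightarrow> nat"
  assumes k: "k \<ge> 3"
    and proper: "\<And>E. E \<in> gadget k a e b \<Longrightarrow> inj_on c E"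
    and range: "\<And>E. E \<in> gadget k a e b \<Longrightarrow> c ` E \<subseteq> {1..k}"
  shows "row_parity a {v. c (Var v True) < c (Var v False)} e = b"
proof -
  have full: "c ` E = {1..k}" if "E \<in> gadget k a e b" for E
    using that k by (intro rainbow_edge_full proper range card_gadget_edge[OF k]) auto
  define P where "P = c ` (\<lambda>x. Aux e (Pal x)) ` {3..k}"
  \<comment> \<open>The colours left over by the palette; each of the four pairs carries exactly
    these.\<close>
  define Q where "Q = {1..k} - P"
  have pairs: "{c (Var (a e i) False), c (Var (a e i) True)} = Q \<and> c (Var (a e i) False) \<noteq> c (Var (a e i) True)"
    if "i < 4" for i
  proof -
    have E: "pair_edge k a e i \<in> gadget k a e b" using that by (auto simp: gadget_def)
    have "{1..k} = {c (Var (a e i) False), c (Var (a e i) True)} \<union> P"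
      unfolding full[OF E, symmetric] by (auto simp: pair_edge_def P_def)
    moreover have "{c (Var (a e i) False), c (Var (a e i) True)} \<inter> P = {}"
      using proper[OF E] by (auto simp: pair_edge_def P_def inj_on_def)
    moreover have "c (Var (a e i) False) \<noteq> c (Var (a e i) True)"
      using proper[OF E] by (auto simp: pair_edge_def inj_on_def)
    ultimately show ?thesis by (auto simp: Q_def)
  qed
  \<comment> \<open>Sorting the two colours lets \<open>x i\<close> refer to the same colour in all
    four pairs.\<close>
  define \<alpha> where "\<alpha> = min (c (Var (a e 0) False)) (c (Var (a e 0) True))"
  define \<beta> where "\<beta> = max (c (Var (a e 0) False)) (c (Var (a e 0) True))"
  have \<alpha>\<beta>: "\<alpha> < \<beta>" "Q = {\<alpha>, \<beta>}" using pairs[of 0] by (auto simp: \<alpha>_def \<beta>_def min_def max_def)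
  define x where "x i \<longleftrightarrow> c (Var (a e i) True) < c (Var (a e i) False)" for i
  have var: "c (Var (a e i) s) = (if x i = s then \<alpha> else \<beta>)" if "i < 4" for i s
    using pairs[OF that] \<alpha>\<beta> by (cases s) (auto simp: x_def doubleton_eq_iff)
  have nae: "\<not> (\<forall>i<4. c (lit a e b j i) = q)" if j: "j < 4" and q: "q \<in> Q" for j q
  proof
    assume eq: "\<forall>i<4. c (lit a e b j i) = q"
    have tri: "c (Aux e (Tri j i)) \<noteq> q" if "i < 4" for i
    proof -
      have "lit_edge k a e b j i \<in> gadget k a e b" using that j by (auto simp: gadget_def)
      from proper[OF this] have "c (Aux e (Tri j i)) \<noteq> c (lit a e b j i)"
        by (auto simp: lit_edge_def lit_def inj_on_def)
      thus ?thesis using eq that by simp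
    qed
    \<comment> \<open>The edge shows all k colours, hence also \<open>q\<close>. Its palette part
      lacks \<open>q\<close> and both \<open>Tri\<close> vertices avoid it, which leaves only
      \<open>Mid j s\<close>.\<close>
    have mid: "c (Aux e (Mid j s)) = q" for s
    proof -
      have "tri_edge k e j s \<in> gadget k a e b" using j by (auto simp: gadget_def)
      from full[OF this] have "q \<in> c ` tri_edge k e j s" using q by (auto simp: Q_def)
      moreover have "q \<noteq> c (Aux e (Pal x))" if "x \<in> {4..k}" for x
        using q that unfolding Q_def P_def image_image by fastforce
      hence "q \<notin> c ` (\<lambda>x. Aux e (Pal x)) ` {4..k}" by blast
      ultimately show ?thesis using tri[of 0] tri[of 1] tri[of 2] tri[of 3]
        unfolding tri_edge_def image_Un by (auto split: if_splits)
    qed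
    have "mid_edge k e j \<in> gadget k a e b" using j by (auto simp: gadget_def)
    from proper[OF this] have "c (Aux e (Mid j False)) \<noteq> c (Aux e (Mid j True))"
      by (auto simp: mid_edge_def inj_on_def)
    thus False using mid by simp
  qed
  have nae': "\<not> (\<forall>i<4. (x i = ((i = j) \<noteq> (b \<and> i = 0))) = p)" if "j < 4" for j p
  proof
    assume *: "\<forall>i<4. (x i = ((i = j) \<noteq> (b \<and> i = 0))) = p"
    have "c (lit a e b j i) = (if p then \<alpha> else \<beta>)" if "i < 4" for i
      unfolding lit_def var[OF that] using *[rule_format, OF that] by (rule if_cong) auto
    hence "\<forall>i<4. c (lit a e b j i) = (if p then \<alpha> else \<beta>)" by blast
    thus False using nae[OF that, of "if p then \<alpha> else \<beta>"] \<alpha>\<beta>(2) by simp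
  qed
  have all4: "(\<forall>i<(4::nat). R i) \<longleftrightarrow> R 0 \<and> R 1 \<and> R 2 \<and> R 3" for R
    by (auto simp: less_Suc_eq numeral_eq_Suc)
  have "row_parity a {v. c (Var v True) < c (Var v False)} e
     = odd (of_bool (x 0) + of_bool (x 1) + of_bool (x 2) + of_bool (x 3) :: nat)"
    unfolding row_parity_def card_less_4 by (simp add: x_def)
  \<comment> \<open>The eight instances exclude all eight vectors of the wrong parity.\<close>
  also have "\<dots> = b"
    using nae'[of 0 True] nae'[of 1 True] nae'[of 2 True] nae'[of 3 True]
      nae'[of 0 False] nae'[of 1 False] nae'[of 2 False] nae'[of 3 False]
    unfolding all4
    by (cases b; cases "x 0"; cases "x 1"; cases "x 2"; cases "x 3"; simp)
  finally show ?thesis .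
qed

lemma exists_fill:
  assumes "p \<in> {1..k}" "q \<in> {1..k}" "p \<noteq> (q::nat)" "k \<ge> 3"
  obtains f where "bij_betw f {3..k} ({1..k} - {p, q})"
proof -
  have "card {3..k} = card ({1..k} - {p, q})" using assms by (simp add: card_Diff_subset)
  thus ?thesis using that finite_same_card_bij[of "{3..k}" "{1..k} - {p, q}"] by auto
qed

text \<open>Colours for \<open>Tri\<close> and \<open>Mid\<close> when the literals, coloured 1 or 2
  according to \<open>z\<close>, are not all equal; colour 3 is the spare one.\<close>

lemma not_all_equal_witness:
  fixes z :: "nat \<Rightarrow> bool"
  assumes "\<not> (z 0 = z 1 \<and> z 1 = z 2 \<and> z 2 = z 3)"
  shows "\<exists>(t::nat \<Rightarrow> nat) (m::bool \<Rightarrow> nat). (\<forall>i<4. t i \<in> {1..3} \<and> t i \<noteq> (if z i then 1 else 2)) \<and> (\<forall>s. m s \<in> {1..3})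
    \<and> distinct [t 0, t 1, m False] \<and> distinct [t 2, t 3, m True] \<and> m False \<noteq> m True"
proof -
  \<comment> \<open>\<open>\<mu>\<close> determines the colour of \<open>Mid j False\<close>. It is
    forced if literals 0 and 1 agree; otherwise it is chosen opposite to literal 2, whose colour
    then goes to \<open>Mid j True\<close>.\<close>
  define \<mu> where "\<mu> = (if z 0 = z 1 then z 0 else \<not> z 2)"
  define C :: "bool \<Rightarrow> nat" where "C p = (if p then 1 else 2)" for p
  define m where "m s = C (\<mu> \<noteq> s)" for s
  define t where "t i = (if i = 0 then if z 0 = \<mu> then C (\<not> \<mu>) else 3
    else if i = 1 then if z 0 = \<mu> then 3 else C (\<not> \<mu>)
    else if i = 2 then if z 2 = \<mu> then 3 else C \<mu>
    else if z 2 = \<mu> then C \<mu> else 3)" for i :: nat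
  have "t i \<in> {1..3} \<and> t i \<noteq> (if z i then 1 else 2)" if "i < 4" for i
  proof -
    have "i = 0 \<or> i = 1 \<or> i = 2 \<or> i = 3" using that by auto
    thus ?thesis using assms by (elim disjE) (auto simp: t_def C_def \<mu>_def)
  qed
  moreover have "m s \<in> {1..3}" for s by (auto simp: m_def C_def)
  moreover have "distinct [t 0, t 1, m False]" "distinct [t 2, t 3, m True]" "m False \<noteq> m True"
    by (auto simp: t_def m_def C_def)
  ultimately show ?thesis by blast
qed

lemma inj_on_Un_image:
  assumes "inj_on c A" "inj_on (\<lambda>x. c (f x)) J" "\<And>y x. y \<in> A \<Longrightarrow> x \<in> J \<Longrightarrow> c y \<noteq> c (f x)"
  shows "inj_on c (A \<union> f ` J)"
  using assms by (auto simp: inj_on_def) metis+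

text \<open>The colours of the variable vertices are fixed by \<open>X\<close> alone and
  \<open>h\<close> only concerns auxiliary vertices, so the colourings of all gadgets can be
  combined.\<close>

lemma gadget_complete:
  fixes a :: "nat \<Rightarrow> nat \<Rightarrow> 'v"
  assumes k: "k \<ge> 3" and parity: "row_parity a X e = b"
  obtains h where "\<And>x. x \<in> aux_vertices k \<Longrightarrow> h x \<in> {1..k}"
    "\<And>c E. (\<And>v s. c (Var v s) = (if (v \<in> X) = s then 1 else 2)) \<Longrightarrow> (\<And>x. c (Aux e x) = h x) \<Longrightarrow>
       E \<in> gadget k a e b \<Longrightarrow> inj_on c E"
proof -
  define C :: "bool \<Rightarrow> nat" where "C p = (if p then 1 else 2)" for p
  \<comment> \<open>\<open>z j i\<close> says that literal \<open>i\<close> in the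
    \<open>j\<close>-th test has colour 1.\<close>
  define z where "z j i \<longleftrightarrow> (a e i \<in> X) = ((i = j) \<noteq> (b \<and> i = 0))" for j i
  have nae: "\<not> (z j 0 = z j 1 \<and> z j 1 = z j 2 \<and> z j 2 = z j 3)" if "j < 4" for j
  proof -
    have "j = 0 \<or> j = 1 \<or> j = 2 \<or> j = 3" using that by auto
    thus ?thesis using parity unfolding row_parity_def card_less_4 z_def
      by (elim disjE; cases b; cases "a e 0 \<in> X"; cases "a e 1 \<in> X"; cases "a e 2 \<in> X"; cases "a e 3 \<in> X"; simp)
  qed
  define ok :: "nat \<Rightarrow> (nat \<Rightarrow> nat) \<Rightarrow> (bool \<Rightarrow> nat) \<Rightarrow> bool" where
    "ok j t m \<longleftrightarrow> (\<forall>i<4. t i \<in> {1..3} \<and> t i \<noteq> C (z j i)) \<and> (\<forall>s. m s \<in> {1..3})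
      \<and> distinct [t 0, t 1, m False] \<and> distinct [t 2, t 3, m True] \<and> m False \<noteq> m True" for j t m
  have "\<exists>t m. ok j t m" if "j < 4" for j
    using not_all_equal_witness[OF nae[OF that]] unfolding ok_def C_def .
  then obtain t m where tm: "\<And>j. j < 4 \<Longrightarrow> ok j (t j) (m j)" by metis
  have t: "t j i \<in> {1..3}" "t j i \<noteq> C (z j i)" if "j < 4" "i < 4" for j i
    using tm[OF that(1)] that(2) by (auto simp: ok_def)
  have m: "m j s \<in> {1..3}" "m j False \<noteq> m j True" if "j < 4" for j s
    using tm[OF that] by (auto simp: ok_def)
  have tm_distinct: "distinct [t j 0, t j 1, m j False]" "distinct [t j 2, t j 3, m j True]" if "j < 4" for j
    using tm[OF that] by (auto simp: ok_def)
  have "\<exists>f. bij_betw f {3..k} ({1..k} - (if i = 4 then {m j False, m j True} else {t j i, C (z j i)}))"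
    if "j < 4" "i \<le> 4" for j i
  proof (cases "i = 4")
    case True
    have "m j False \<in> {1..k}" "m j True \<in> {1..k}" using m(1)[OF that(1)] k by (meson atLeastAtMost_iff order_trans)+
    from exists_fill[OF this m(2)[OF that(1)] k] show ?thesis using True by auto
  next
    case False
    hence i: "i < 4" using that by simp
    have "t j i \<in> {1..k}" "C (z j i) \<in> {1..k}" using t(1)[OF that(1) i] k by (auto simp: C_def)
    from exists_fill[OF this t(2)[OF that(1) i] k] show ?thesis using False by auto
  qed
  then obtain f where f: "\<And>j i. j < 4 \<Longrightarrow> i \<le> 4 \<Longrightarrow>
      bij_betw (f j i) {3..k} ({1..k} - (if i = 4 then {m j False, m j True} else {t j i, C (z j i)}))"
    by metis
  define h where "h x = (case x of Pal c \<Rightarrow> c | Tri j i \<Rightarrow> t j i | Mid j s \<Rightarrow> m j s | Fill j i c \<Rightarrow> f j i c)" for x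
  show ?thesis
  proof (rule that[of h])
    fix x assume "x \<in> aux_vertices k"
    then consider c where "x = Pal c" "c \<in> {3..k}" | j i where "x = Tri j i" "j < 4" "i < 4"
      | j s where "x = Mid j s" "j < 4" | j i c where "x = Fill j i c" "j < 4" "i \<le> 4" "c \<in> {3..k}"
      by (auto simp: aux_vertices_def)
    thus "h x \<in> {1..k}"
    proof cases
      case 4
      with bij_betwE[OF f[OF 4(2,3)]] show ?thesis by (auto simp: h_def)
    next
      case 2
      with t(1)[OF 2(2,3)] k show ?thesis by (auto simp: h_def)
    next
      case 3
      with m(1)[OF 3(2)] k show ?thesis by (simp add: h_def) (meson order_trans)
    qed (auto simp: h_def)
  next
    fix c :: "'v vertex \<Rightarrow> nat" and E
    assume c: "\<And>v s. c (Var v s) = (if (v \<in> X) = s then 1 else 2)" "\<And>x. c (Aux e x) = h x"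
      and "E \<in> gadget k a e b"
    then consider i where "E = pair_edge k a e i" "i < 4" | j i where "E = lit_edge k a e b j i" "j < 4" "i < 4"
      | j s where "E = tri_edge k e j s" "j < 4" | j where "E = mid_edge k e j" "j < 4"
      by (auto simp: gadget_def)
    thus "inj_on c E"
    proof cases
      case 1
      show ?thesis unfolding 1 pair_edge_def
        by (intro inj_on_Un_image) (auto simp: c h_def inj_on_def split: if_splits)
    next
      case 2
      have lit: "c (lit a e b j i) = C (z j i)" by (simp add: lit_def c z_def C_def)
      have B: "bij_betw (f j i) {3..k} ({1..k} - {t j i, C (z j i)})" using f[of j i] 2 by simp
      have "f j i x \<in> {1..k} - {t j i, C (z j i)}" if "x \<in> {3..k}" for x
        using bij_betwE[OF B] that by blast
      moreover have "inj_on (f j i) {3..k}" using B by (simp add: bij_betw_def)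
      moreover have "inj_on c {Aux e (Tri j i), lit a e b j i}"
        using t(2)[OF 2(2,3)] by (auto simp: inj_on_def lit) (auto simp: c h_def)
      ultimately show ?thesis unfolding 2 lit_edge_def
        by (intro inj_on_Un_image) (force simp: c(2) h_def lit)+
    next
      case 3
      have "t j i \<le> 3 \<and> m j s \<le> 3" if "i < 4" for i
        using t(1)[OF 3(2) that] m(1)[OF 3(2), of s] by auto
      from this[of 0] this[of 1] this[of 2] this[of 3] tm_distinct[OF 3(2)] show ?thesis
        unfolding 3 tri_edge_def
        by (cases s; intro inj_on_Un_image) (auto simp: c(2) h_def inj_on_def)
    next
      case 4
      have B: "bij_betw (f j 4) {3..k} ({1..k} - {m j False, m j True})" using f[of j 4] 4 by simp
      have "f j 4 x \<in> {1..k} - {m j False, m j True}" if "x \<in> {3..k}" for x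
        using bij_betwE[OF B] that by blast
      moreover have "inj_on (f j 4) {3..k}" using B by (simp add: bij_betw_def)
      ultimately show ?thesis using m(2)[OF 4(2)] unfolding 4 mid_edge_def
        by (intro inj_on_Un_image) (force simp: c(2) h_def inj_on_def)+
    qed
  qed
qed

section \<open>The hard instances\<close>

lemma Var_in_gadget_edge:
  assumes "E \<in> gadget k a e b" "Var w s \<in> E"
  obtains i where "i < 4" "a e i = w"
  using gadget_edge_subset[OF assms(1)] assms(2) by auto

lemma Aux_in_gadget_edge: "E \<in> gadget k a e b \<Longrightarrow> Aux e' x \<in> E \<Longrightarrow> e' = e"
  using gadget_edge_subset[of E k a e b] by auto

text \<open>Numbers in \<open>{1..n}\<close> missed by \<open>enc\<close> are isolated vertices, so
  the construction is not tied to special values of \<open>n\<close>.\<close>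

locale parity_hypergraph =
  fixes k N n :: nat and a :: "nat \<Rightarrow> nat \<Rightarrow> 'v" and W :: "'v set" and enc :: "'v vertex \<Rightarrow> nat"
  assumes k: "k \<ge> 3"
    and finite_W: "finite W" and card_W: "card W \<le> 2 * N"
    and a_in_W: "\<And>e i. e < 4*N \<Longrightarrow> i < 4 \<Longrightarrow> a e i \<in> W"
    and occurrences: "\<And>w. card {(e, i) \<in> {..<4*N} \<times> {..<4}. a e i = w} \<le> 16"
    and expanding: "\<And>S. S \<subseteq> {..<4*N} \<Longrightarrow> S \<noteq> {} \<Longrightarrow> 1728 * card S \<le> N
        \<Longrightarrow> card (case_prod a ` (S \<times> {..<4})) > 2 * card S"
    and inj_enc: "inj_on enc (case_prod Var ` (W \<times> UNIV) \<union> case_prod Aux ` ({..<4*N} \<times> aux_vertices k))"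
    and enc_range: "enc ` (case_prod Var ` (W \<times> UNIV) \<union> case_prod Aux ` ({..<4*N} \<times> aux_vertices k)) \<subseteq> {1..n}"
begin

definition V :: "'v vertex set" where
  "V = case_prod Var ` (W \<times> UNIV) \<union> case_prod Aux ` ({..<4*N} \<times> aux_vertices k)"

definition hyper :: "nat set \<Rightarrow> nat set set" where
  "hyper B = (\<Union>e<4*N. image enc ` gadget k a e (e \<in> B))"

text \<open>Ranging over both values of \<open>b\<close> makes this set independent of the
  right-hand side \<open>B\<close>, as the fooling argument requires.\<close>

definition touch :: "nat \<Rightarrow> nat set" where
  "touch i = {e. e < 4*N \<and> (\<exists>b. \<exists>E\<in>gadget k a e b. i \<in> enc ` E)}"

definition parities :: "'v set \<Rightarrow> nat set" where
  "parities X = {e. e < 4*N \<and> row_parity a X e}"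

lemma enc_eq_iff: "x \<in> V \<Longrightarrow> y \<in> V \<Longrightarrow> enc x = enc y \<longleftrightarrow> x = y"
  using inj_enc unfolding V_def[symmetric] by (auto dest: inj_onD)

lemma enc_V: "x \<in> V \<Longrightarrow> enc x \<in> {1..n}"
  using enc_range unfolding V_def[symmetric] by blast

lemma gadget_edge_V:
  assumes "e < 4*N" "E \<in> gadget k a e b"
  shows "E \<subseteq> V"
proof -
  have "a e ` {..<4} \<subseteq> W" using a_in_W assms(1) by auto
  hence "case_prod Var ` (a e ` {..<4} \<times> UNIV) \<subseteq> case_prod Var ` (W \<times> UNIV)"
    by (intro image_mono Sigma_mono order_refl)
  moreover have "(Aux e ` aux_vertices k :: 'v vertex set) \<subseteq> case_prod Aux ` ({..<4*N} \<times> aux_vertices k)"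
    using assms(1) by auto
  ultimately show ?thesis
    unfolding V_def by (rule order.trans[OF gadget_edge_subset[OF assms(2)] Un_mono])
qed

lemma inj_enc_edge: "e < 4*N \<Longrightarrow> E \<in> gadget k a e b \<Longrightarrow> inj_on enc E"
  using gadget_edge_V inj_enc unfolding V_def[symmetric] by (meson inj_on_subset)

lemma uniform_hyper: "uniform_hypergraph k n (hyper B)"
  unfolding uniform_hypergraph_def hyper_def k_subsets_def
proof safe
  fix e E x assume e: "e < 4*N" "E \<in> gadget k a e (e \<in> B)"
  show "card (enc ` E) = k" using card_image[OF inj_enc_edge[OF e]] card_gadget_edge[OF k e(2)] by simp
  assume "x \<in> E"
  thus "enc x \<in> {1..n}" using gadget_edge_V[OF e] enc_V by blast
qed

lemma finite_hyper: "finite (hyper B)"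
  by (simp add: hyper_def finite_gadget)

lemma touch_le: "touch i \<subseteq> {..<4*N}"
  by (auto simp: touch_def)

lemma touch_vertex:
  assumes "v \<in> V"
  shows "touch (enc v) = {e. e < 4*N \<and> (\<exists>b. \<exists>E\<in>gadget k a e b. v \<in> E)}"
proof -
  have "enc v \<in> enc ` E \<longleftrightarrow> v \<in> E" if "e < 4*N" "E \<in> gadget k a e b" for e E b
    using gadget_edge_V[OF that] assms enc_eq_iff by blast
  thus ?thesis unfolding touch_def by blast
qed

text \<open>A variable vertex lies only in gadgets of the at most 16 slots holding its variable, an
  auxiliary vertex only in its own gadget.\<close>

lemma card_touch: "card (touch i) \<le> 16"
proof (cases "i \<in> enc ` V")
  case False
  hence "touch i = {}" using gadget_edge_V unfolding touch_def by blast
  thus ?thesis by simp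
next
  case True
  then obtain v where v: "v \<in> V" "i = enc v" by blast
  show ?thesis
  proof (cases v)
    case (Var w s)
    have "touch i \<subseteq> fst ` {(e, i) \<in> {..<4*N} \<times> {..<4}. a e i = w}"
    proof
      fix e assume "e \<in> touch i"
      then obtain b E where "e < 4*N" "E \<in> gadget k a e b" "Var w s \<in> E"
        using touch_vertex[OF v(1)] v(2) Var by auto
      thus "e \<in> fst ` {(e, i) \<in> {..<4*N} \<times> {..<4}. a e i = w}"
        by (elim Var_in_gadget_edge) (auto intro!: image_eqI[of _ _ "(e, _)"])
    qed
    hence "card (touch i) \<le> card {(e, i) \<in> {..<4*N} \<times> {..<4}. a e i = w}"
      by (intro surj_card_le) (auto intro: finite_subset[of _ "{..<4*N} \<times> {..<4}"])
    thus ?thesis using occurrences order_trans by blast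
  next
    case (Aux e x)
    have "touch i \<subseteq> {e}"
      using touch_vertex[OF v(1)] v(2) Aux by (auto dest: Aux_in_gadget_edge)
    hence "card (touch i) \<le> card {e}" by (intro card_mono) auto
    thus ?thesis by simp
  qed
qed

lemma edges_at: "{E \<in> hyper B. i \<in> E} = {E \<in> (\<Union>e\<in>touch i. image enc ` gadget k a e (e \<in> B)). i \<in> E}"
  by (auto simp: hyper_def touch_def)

text \<open>At most 16 gadgets meet at a vertex, with at most 32 edges each.\<close>

lemma max_degree_hyper: "max_degree_le 512 n (hyper B)"
  unfolding max_degree_le_def
proof
  fix i
  have fin: "finite (touch i)" using touch_le finite_subset by blast
  have "card {E \<in> hyper B. i \<in> E} \<le> card (\<Union>e\<in>touch i. image enc ` gadget k a e (e \<in> B))"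
    unfolding edges_at using fin by (intro card_mono) (auto simp: finite_gadget)
  also have "\<dots> \<le> (\<Sum>e\<in>touch i. card (image enc ` gadget k a e (e \<in> B)))"
    by (rule card_UN_le[OF fin])
  also have "\<dots> \<le> (\<Sum>e\<in>touch i. 32)"
    by (intro sum_mono order.trans[OF card_image_le] card_gadget finite_gadget)
  also have "\<dots> \<le> 16 * 32" using card_touch[of i] by simp
  finally show "card {E \<in> hyper B. i \<in> E} \<le> 512" by simp
qed

text \<open>The order \<open>L\<close> is fixed, so the list of \<open>i\<close>, with its positions
  and padding, is determined by the edges at \<open>i\<close>.\<close>

lemma list_access_local:
  assumes "B \<inter> touch i = B' \<inter> touch i"
  shows "list_access \<Delta> n L (hyper B) i j = list_access \<Delta> n L (hyper B') i j"
proof -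
  have "(e \<in> B) = (e \<in> B')" if "e \<in> touch i" for e using that assms by blast
  hence "{E \<in> hyper B. i \<in> E} = {E \<in> hyper B'. i \<in> E}" unfolding edges_at by simp
  hence "(\<lambda>E. E \<in> hyper B \<and> i \<in> E) = (\<lambda>E. E \<in> hyper B' \<and> i \<in> E)" by (simp add: set_eq_iff)
  thus ?thesis by (simp add: list_access_def incidence_list_def)
qed

lemma k_partite_hyper: "k_partite k n (hyper (parities X))"
proof -
  define good where "good e h \<longleftrightarrow> (\<forall>x\<in>aux_vertices k. h x \<in> {1..k}) \<and>
    (\<forall>c E. (\<forall>v s. c (Var v s) = (if (v \<in> X) = s then 1 else 2)) \<longrightarrow> (\<forall>x. c (Aux e x) = h x) \<longrightarrow>
       E \<in> gadget k a e (row_parity a X e) \<longrightarrow> inj_on c E)" for e h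
  have "\<exists>h. good e h" for e
  proof (rule gadget_complete[OF k, of a X e, OF refl])
    fix h
    assume "\<And>x. x \<in> aux_vertices k \<Longrightarrow> h x \<in> {1..k}"
      "\<And>c E. (\<And>v s. c (Var v s) = (if (v \<in> X) = s then 1 else 2)) \<Longrightarrow> (\<And>x. c (Aux e x) = h x) \<Longrightarrow>
         E \<in> gadget k a e (row_parity a X e) \<Longrightarrow> inj_on c E"
    hence "good e h" unfolding good_def by blast
    thus ?thesis by (rule exI[of _ h])
  qed
  then obtain h where "\<And>e. good e (h e)" by metis
  hence h: "\<And>e x. x \<in> aux_vertices k \<Longrightarrow> h e x \<in> {1..k}"
    "\<And>e c E. (\<And>v s. c (Var v s) = (if (v \<in> X) = s then 1 else 2)) \<Longrightarrow> (\<And>x. c (Aux e x) = h e x) \<Longrightarrow>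
         E \<in> gadget k a e (row_parity a X e) \<Longrightarrow> inj_on c E"
    unfolding good_def by blast+
  define c where "c v = (case v of Var v s \<Rightarrow> if (v \<in> X) = s then 1 else 2 | Aux e x \<Rightarrow> h e x)" for v
  \<comment> \<open>Isolated vertices get the default colour 1.\<close>
  define c' where "c' i = (if i \<in> enc ` V then c (inv_into V enc i) else 1)" for i
  have inj: "inj_on enc V" using inj_enc by (simp add: V_def)
  have c'_enc: "c' (enc v) = c v" if "v \<in> V" for v using that inj by (simp add: c'_def)
  have c_range: "c v \<in> {1..k}" if "v \<in> V" for v
    using that h(1) k by (auto simp: V_def c_def)
  have "c' ` {1..n} \<subseteq> {1..k}" using c_range c'_enc k by (auto simp: c'_def)
  moreover have "inj_on c' E" if "E \<in> hyper (parities X)" for E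
  proof -
    from that obtain e D where e: "e < 4*N" "D \<in> gadget k a e (row_parity a X e)" "E = enc ` D"
      by (auto simp: hyper_def parities_def)
    have "inj_on c D" by (rule h(2)[OF _ _ e(2)]) (simp_all add: c_def)
    moreover have "(c' \<circ> enc) v = c v" if "v \<in> D" for v
      using gadget_edge_V[OF e(1,2)] that c'_enc by auto
    ultimately have "inj_on (c' \<circ> enc) D" using inj_on_cong by blast
    thus ?thesis unfolding e(3) by (rule inj_on_imageI)
  qed
  ultimately show ?thesis unfolding k_partite_def by blast
qed

text \<open>Every edge of a gadget contains a private vertex of the gadget, so distinct broken gadgets
  account for distinct removed edges.\<close>

lemma near_k_partite_imp_near_parities:
  assumes E': "k_partite k n E'" and B: "B \<subseteq> {..<4*N}"
  obtains X where "X \<subseteq> W" "card (sym_diff B (parities X)) \<le> card (hyper B - E')"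
proof -
  from E' obtain c' where c': "c' ` {1..n} \<subseteq> {1..k}" "\<And>E. E \<in> E' \<Longrightarrow> inj_on c' E"
    by (auto simp: k_partite_def)
  define c where "c = c' \<circ> enc"
  \<comment> \<open>Cutting down to \<open>W\<close> leaves at most 2^(2N) candidate assignments and
    changes no row, since all variables of the rows lie in \<open>W\<close>.\<close>
  define X where "X = {v. c (Var v True) < c (Var v False)} \<inter> W"
  have intact: "row_parity a X e = (e \<in> B)"
    if e: "e < 4*N" and sub: "image enc ` gadget k a e (e \<in> B) \<subseteq> E'" for e
  proof -
    have "{i. i < 4 \<and> a e i \<in> X} = {i. i < 4 \<and> a e i \<in> {v. c (Var v True) < c (Var v False)}}"
      using a_in_W[OF e] by (auto simp: X_def)
    hence "row_parity a X e = row_parity a {v. c (Var v True) < c (Var v False)} e"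
      by (simp only: row_parity_def)
    also have "\<dots> = (e \<in> B)"
    proof (rule gadget_sound[OF k])
      fix E assume E: "E \<in> gadget k a e (e \<in> B)"
      show "inj_on c E" unfolding c_def using c'(2) sub E by (intro comp_inj_on inj_enc_edge[OF e E]) auto
      show "c ` E \<subseteq> {1..k}" using gadget_edge_V[OF e E] enc_V c'(1) unfolding c_def by fastforce
    qed
    finally show ?thesis .
  qed
  define D where "D = sym_diff B (parities X)"
  have "\<exists>E. E \<in> gadget k a e (e \<in> B) \<and> enc ` E \<notin> E'" if "e \<in> D" for e
  proof -
    have "e < 4*N" "row_parity a X e \<noteq> (e \<in> B)" using that B by (auto simp: D_def parities_def)
    thus ?thesis using intact by blast
  qed
  then obtain F where F: "\<And>e. e \<in> D \<Longrightarrow> F e \<in> gadget k a e (e \<in> B) \<and> enc ` F e \<notin> E'" by metis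
  have D: "e < 4*N" if "e \<in> D" for e using that B by (auto simp: D_def parities_def)
  have "inj_on (\<lambda>e. enc ` F e) D"
  proof (rule inj_onI)
    fix e e' assume e: "e \<in> D" "e' \<in> D" "enc ` F e = enc ` F e'"
    obtain x where x: "x \<in> aux_vertices k" "Aux e x \<in> F e"
      using gadget_edge_has_aux[OF k] F[OF e(1)] by metis
    have FV: "F e \<subseteq> V" "F e' \<subseteq> V" using gadget_edge_V D e F by blast+
    have "enc (Aux e x) \<in> enc ` F e'" using e(3) x(2) by blast
    hence "Aux e x \<in> F e'" using FV x(2) enc_eq_iff by blast
    thus "e = e'" using F[OF e(2)] Aux_in_gadget_edge by blast
  qed
  moreover have "(\<lambda>e. enc ` F e) ` D \<subseteq> hyper B - E'"
    using F D by (auto simp: hyper_def)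
  ultimately have "card D \<le> card (hyper B - E')"
    using finite_hyper by (intro card_inj_on_le[of "\<lambda>e. enc ` F e"]) auto
  thus ?thesis using that[of X] by (auto simp: D_def X_def)
qed

text \<open>Making the hypergraph k-partite removes an edge for every violated equation, hence more
  than N/6 edges.\<close>

lemma far_from_k_partite:
  assumes "n > 0" "B \<subseteq> {..<4*N}" "\<not> (\<exists>X\<in>Pow W. card (sym_diff B (parities X)) \<le> N div 6)"
    and \<epsilon>: "\<epsilon> * (6 * 512 * real n) \<le> real N"
  shows "far_from k 512 n \<epsilon> (k_partite k n) (hyper B)"
  unfolding far_from_def
proof (intro allI impI, elim conjE)
  fix E' assume "k_partite k n E'"
  then obtain X where X: "X \<subseteq> W" "card (sym_diff B (parities X)) \<le> card (hyper B - E')"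
    using near_k_partite_imp_near_parities assms(2) by blast
  hence "N div 6 < card (hyper B - E')" using assms(3) by (meson PowI not_less order_trans)
  hence "N < 6 * card (hyper B - E')" by simp
  hence "real N < 6 * real (card (hyper B - E') + card (E' - hyper B))" by simp
  with \<epsilon> have "\<epsilon> * (512 * real n) < real (card (hyper B - E') + card (E' - hyper B))" by simp
  thus "\<epsilon> < hg_dist 512 n (hyper B) E'"
    unfolding hg_dist_def using assms(1) by (simp add: field_simps)
qed

section \<open>Fooling a tester with few queries\<close>

lemma parities_uniform:
  assumes "R \<subseteq> {..<4*N}" "card R \<le> N div 1728"
  shows "card {X \<in> Pow W. parities X \<inter> R = \<beta> \<inter> R} * 2 ^ card R = card (Pow W)"
proof -
  have "parities X \<inter> R = \<beta> \<inter> R \<longleftrightarrow> (\<forall>e\<in>R. row_parity a X e = (e \<in> \<beta>))" for X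
    using assms(1) by (auto simp: parities_def)
  moreover have "finite R" using assms(1) finite_subset by blast
  ultimately show ?thesis
    using card_row_parity_prescribed[OF finite_W, of "{..<4*N}" a "N div 1728" R \<beta>]
      a_in_W expanding assms finite_W by (simp add: card_Pow flip: Pow_def)
qed

text \<open>The mean acceptance probability is at least 2/3 over satisfiable instances and at most
  1/3 + 1/4 = 7/12 over all right-hand sides, yet few queries force the two means to
  coincide.\<close>

lemma no_fast_tester:
  assumes N: "N \<ge> 3" and n: "n > 0" and \<epsilon>: "\<epsilon> * (6 * 512 * real n) \<le> real N"
    and T: "is_tester k 512 \<epsilon> n L (k_partite k n) T"
    and q: "16 * q \<le> N div 1728"
  shows "\<not> worst_case_queries k 512 n L T \<le> enat q"
proof
  assume le: "worst_case_queries k 512 n L T \<le> enat q"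
  define M where "M = {..<4*N}"
  define pr where "pr B = accept_prob 512 n L T (hyper B)" for B
  have queries: "num_queries (list_access 512 n L (hyper B)) t \<le> q" if "t \<in> set_pmf T" for B t
  proof -
    have "enat (num_queries (list_access 512 n L (hyper B)) t) \<le> worst_case_queries k 512 n L T"
      unfolding worst_case_queries_def using that uniform_hyper max_degree_hyper
      by (intro SUP_upper2[of "(hyper B, t)"]) auto
    thus ?thesis using le by (metis enat_ord_simps(1) order_trans)
  qed
  have "(\<Sum>X\<in>Pow W. pr (parities X)) * 2 ^ card M = (\<Sum>B\<in>Pow M. pr B) * real (card (Pow W))"
    unfolding pr_def accept_prob_def
  proof (rule tester_fooled[where touch=touch and r="N div 1728" and D=16 and q=q])
    show "card {X \<in> Pow W. parities X \<inter> R = \<beta> \<inter> R} * 2 ^ card R = card (Pow W)"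
      if "R \<subseteq> M" "card R \<le> N div 1728" for R \<beta>
      using parities_uniform that unfolding M_def .
    show "list_access 512 n L (hyper B) i j = list_access 512 n L (hyper B') i j"
      if "B \<inter> touch i = B' \<inter> touch i" for B B' i j
      by (rule list_access_local[OF that])
    show "parities X \<subseteq> M" for X by (auto simp: parities_def M_def)
    show "touch i \<subseteq> M" for i using touch_le by (simp add: M_def)
  qed (use card_touch queries q finite_W in \<open>auto simp: M_def\<close>)
  moreover have "(\<Sum>X\<in>Pow W. pr (parities X)) \<ge> real (card (Pow W)) * (2/3)"
  proof -
    have "2/3 \<le> pr (parities X)" for X
      using T uniform_hyper max_degree_hyper k_partite_hyper unfolding is_tester_def pr_def by blast
    thus ?thesis using sum_bounded_below[of "Pow W" "2/3" "\<lambda>X. pr (parities X)"] by simp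
  qed
  moreover have "(\<Sum>B\<in>Pow M. pr B) \<le> (7/12) * 2 ^ card M"
  proof -
    define near where "near = {B \<in> Pow M. \<exists>X\<in>Pow W. card (sym_diff B (parities X)) \<le> N div 6}"
    have "4 * card near \<le> 2 ^ (4 * N)"
      unfolding near_def using N finite_W card_W
      by (intro card_near_image_le) (auto simp: M_def card_Pow parities_def)
    hence "real (4 * card near) \<le> real (2 ^ (4 * N))" by (simp only: of_nat_le_iff)
    hence near: "4 * real (card near) \<le> 2 ^ card M" by (simp add: M_def)
    \<comment> \<open>The tester promises nothing on right-hand sides near a satisfiable one, but
      these are at most a quarter of all.\<close>
    have "pr B \<le> 1 / 3 + indicator near B" if "B \<in> Pow M" for B
    proof (cases "B \<in> near")
      case True
      have "pr B \<le> 1" unfolding pr_def accept_prob_def by (rule measure_pmf.prob_le_1)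
      thus ?thesis by (simp add: True)
    next
      case False
      with that have "far_from k 512 n \<epsilon> (k_partite k n) (hyper B)"
        by (intro far_from_k_partite n \<epsilon>) (auto simp: near_def M_def)
      hence "pr B \<le> 1 / 3" using T uniform_hyper max_degree_hyper unfolding is_tester_def pr_def by blast
      thus ?thesis by (simp add: False)
    qed
    hence "(\<Sum>B\<in>Pow M. pr B) \<le> (\<Sum>B\<in>Pow M. 1 / 3 + indicator near B)" by (rule sum_mono)
    also have "\<dots> = 2 ^ card M / 3 + real (card near)"
    proof -
      have "Pow M \<inter> near = near" by (auto simp: near_def)
      hence "(\<Sum>B\<in>Pow M. indicator near B) = real (card near)"
        by (simp add: indicator_def sum.If_cases Int_def M_def)
      thus ?thesis by (simp add: sum.distrib card_Pow M_def)
    qed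
    also have "\<dots> \<le> (7/12) * 2 ^ card M" using near by simp
    finally show ?thesis .
  qed
  ultimately have "real (card (Pow W)) * (2/3) * 2 ^ card M \<le> (7/12) * 2 ^ card M * real (card (Pow W))"
    by (smt (verit, ccfv_SIG) mult_right_mono of_nat_0_le_iff zero_le_power)
  moreover have "real (card (Pow W)) * 2 ^ card M > 0" using finite_W by (simp add: card_Pow)
  ultimately show False by (simp add: mult_ac)
qed

end

section \<open>Choice of the constants and the linear bound\<close>

theorem theorem2:
  fixes k :: nat
  assumes "k \<ge> 3"
  shows "\<exists>(d::nat) (\<epsilon>::real). d > 0 \<and> \<epsilon> > 0 \<and>
    (\<forall>L. (\<forall>n. edge_order k n (L n)) \<longrightarrow>
       at_least_linear (\<lambda>n. query_complexity k d \<epsilon> n (L n) (k_partite k n)))"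
proof -
  define G where "G = card (aux_vertices k)"
  \<comment> \<open>Vertices needed per unit of N: two for each of 2N variables and \<open>G\<close>
    for each of 4N rows.\<close>
  define K where "K = 4 * (1 + G)"
  \<comment> \<open>Matches n <= 2KN, where the factor 2 pays for rounding in
    \<open>n div K\<close>.\<close>
  define \<epsilon> :: real where "\<epsilon> = 1 / (6 * 512 * (2 * real K))"
  have K: "K > 0" by (simp add: K_def)
  have bound: "ereal (1 / (27648 * real K) * real n) \<le> ereal_of_enat (query_complexity k 512 \<epsilon> n L (k_partite k n))"
    if n: "n \<ge> 3 * K" for n L
  proof -
    define N where "N = n div K"
    define q where "q = N div 1728 div 16"
    have N: "N \<ge> 3" using n K by (simp add: N_def less_eq_div_iff_mult_less_eq)
    have n_le: "n < K * (N + 1)" "K * N \<le> n"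
      using K unfolding N_def by (auto simp: dividend_less_times_div mult.commute)
    obtain a :: "nat \<Rightarrow> nat \<Rightarrow> nat \<times> nat" and W where aW:
      "finite W" "card W \<le> 2 * N" "\<And>e i. e < 4*N \<Longrightarrow> i < 4 \<Longrightarrow> a e i \<in> W"
      "\<And>w. card {(e, i) \<in> {..<4*N} \<times> {..<4}. a e i = w} \<le> 16"
      "\<And>S. S \<subseteq> {..<4*N} \<Longrightarrow> S \<noteq> {} \<Longrightarrow> 1728 * card S \<le> N
        \<Longrightarrow> card (case_prod a ` (S \<times> {..<4})) > 2 * card S"
      by (rule exists_sparse_expander[of N]) (use N in auto)
    let ?V = "case_prod Var ` (W \<times> UNIV) \<union> case_prod Aux ` ({..<4*N} \<times> aux_vertices k)"
    have "card ?V \<le> card (W \<times> (UNIV::bool set)) + card ({..<4*N} \<times> aux_vertices k)"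
      using aW(1) finite_aux_vertices
      by (intro order.trans[OF card_Un_le] add_mono card_image_le) auto
    also have "\<dots> \<le> 4 * N + 4 * N * G"
      using aW(2) by (simp add: card_cartesian_product G_def)
    also have "\<dots> = K * N" by (simp add: K_def algebra_simps)
    finally have "card ?V \<le> card {1..n}" using n_le by simp
    moreover have "finite ?V" using aW(1) finite_aux_vertices by simp
    ultimately obtain enc where enc: "enc ` ?V \<subseteq> {1..n}" "inj_on enc ?V"
      using card_le_inj[of ?V "{1..n}"] by auto
    interpret parity_hypergraph k N n a W enc
      by unfold_locales (use assms aW enc in auto)
    have "real n \<le> 2 * real K * real N"
    proof -
      have "K * (N + 1) \<le> 2 * K * N" using N by (simp add: algebra_simps)
      hence "n \<le> 2 * K * N" using n_le by linarith
      thus ?thesis by (metis of_nat_le_iff of_nat_mult of_nat_numeral)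
    qed
    hence \<epsilon>: "\<epsilon> * (6 * 512 * real n) \<le> real N" using K by (simp add: \<epsilon>_def field_simps)
    have "enat (Suc q) \<le> query_complexity k 512 \<epsilon> n L (k_partite k n)"
      unfolding query_complexity_def
    proof (rule INF_greatest)
      fix T assume "T \<in> {T. is_tester k 512 \<epsilon> n L (k_partite k n) T}"
      hence "\<not> worst_case_queries k 512 n L T \<le> enat q"
        using N n K \<epsilon> by (intro no_fast_tester) (auto simp: q_def)
      thus "enat (Suc q) \<le> worst_case_queries k 512 n L T"
        by (simp add: not_le ileI1 flip: eSuc_enat)
    qed
    hence "ereal_of_enat (enat (Suc q)) \<le> ereal_of_enat (query_complexity k 512 \<epsilon> n L (k_partite k n))"
      by (simp only: ereal_of_enat_le_iff)
    moreover have "1 / (27648 * real K) * real n \<le> real (Suc q)"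
    proof -
      \<comment> \<open>27648 = 1728 * 16; the successor absorbs the rounding in both
        divisions.\<close>
      have "N + 1 \<le> 27648 * Suc q" unfolding q_def by simp
      hence "K * (N + 1) \<le> K * (27648 * Suc q)" by (rule mult_le_mono2)
      hence "n \<le> K * (27648 * Suc q)" using n_le by linarith
      hence "real n \<le> real K * (27648 * real (Suc q))"
        by (metis of_nat_le_iff of_nat_mult of_nat_numeral)
      thus ?thesis using K by (simp add: field_simps)
    qed
    ultimately show ?thesis by (metis ereal_less_eq(3) ereal_of_enat_simps(1) order_trans)
  qed
  have "at_least_linear (\<lambda>n. query_complexity k 512 \<epsilon> n (L n) (k_partite k n))" for L
    unfolding at_least_linear_def
    using bound K by (intro exI[of _ "1 / (27648 * real K)"] conjI eventually_sequentiallyI[of "3 * K"]) auto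
  moreover have "\<epsilon> > 0" using K by (simp add: \<epsilon>_def)
  ultimately show ?thesis by (intro exI[of _ 512] exI[of _ \<epsilon>]) auto
qed

end
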